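(* Let $m\ge 2$, let $f\in\mathbb{R}^{d_1\times\cdots\times d_m}$ be a nonnegative weakly irreducible tensor and let $1<p_1,\ldots,p_m<\infty$ be such that there exists $i\in[m]$ with $$m-1\le (p_i-1)\Big(\min_{k\in[m]\setminus\{i\}}p_k-(m-1)\Big).$$ Then there exists a unique vector $\mathbf x^*\in\mathcal S^d_{++}$ such that $Q(\mathbf x^* )=\|f\|_{p_1,\ldots,p_m}$. Furthermore, $$\max_{\mathbf x\in\mathcal S^d_{++}}\ \prod_{\nu\in[m]\setminus\{i\}}\ \min_{j_\nu\in[d_\nu]}\Big(\frac{s_{i,\nu,j_\nu}(\mathbf x)}{x_{\nu,j_\nu}}\Big)^{p_\nu-1}=\|f\|_{p_1,\ldots,p_m}^{p_i'(m-1)}=\min_{\mathbf x\in\mathcal S^d_{++}}\ \prod_{\nu\in[m]\setminus\{i\}}\ \max_{j_\nu\in[d_\nu]}\Big(\frac{s_{i,\nu,j_\nu}(\mathbf x)}{x_{\nu,j_\nu}}\Big)^{p_\nu-1},$$ and if $f$ is irreducible then $\mathbf x^*>0$ is the unique nonnegative $\ell^{p_1,\ldots,p_m}$ singular vector of $f$, up to scale.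
   Context: $[n]=\{1,\dots,n\}$. A tensor $f\in\mathbb{R}^{d_1\times\cdots\times d_m}$ is identified with the multilinear form $f(\mathbf x_1,\ldots,\mathbf x_m)=\sum_{j_1\in[d_1],\ldots,j_m\in[d_m]}f_{j_1,\ldots,j_m}x_{1,j_1}\cdots x_{m,j_m}$ on $\mathcal R^d:=\mathbb{R}^{d_1}\times\cdots\times\mathbb{R}^{d_m}$, with $\mathbf x=(\mathbf x_1,\dots,\mathbf x_m)$, $\mathbf x_k=(x_{k,1},\dots,x_{k,d_k})$. Inequalities are entrywise ($f\ge0$: all entries nonnegative; $\mathbf x>0$: all entries positive). For $1<p<\infty$, $p'=p/(p-1)$. For $1<q<\infty$, $\psi_q:\mathbb{R}^n\to\mathbb{R}^n$, $(\psi_q(\mathbf y))_j=|y_j|^{q-1}\mathrm{sign}(y_j)$. $Q(\mathbf x)=|f(\mathbf x)|/(\|\mathbf x_1\|_{p_1}\cdots\|\mathbf x_m\|_{p_m})$ and $\|f\|_{p_1,\ldots,p_m}=\max Q$ over $\mathbf x$ with all $\mathbf x_k\neq0$. $\mathcal S^d_{++}=\{\mathbf x\in\mathcal R^d:\mathbf x>0,\ \|\mathbf x_k\|_{p_k}=1\ \forall k\}$. An $\ell^{p_1,\ldots,p_m}$ singular vector of $f$ is a critical point $\mathbf x$ of $Q$ with all $\mathbf x_k\ne0$ and $f(\mathbf x)\neq 0$ (singular value $Q(\mathbf x)$). $\partial_{k,j_k}=\partial/\partial x_{k,j_k}$, $\nabla_k f(\mathbf x)=(\partial_{k,1}f(\mathbf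 x),\dots,\partial_{k,d_k}f(\mathbf x))$. For $k\ne i$ and $j_k\in[d_k]$: $s_{i,k,j_k}(\mathbf x)=\psi_{p_k'}\big(\sum_{j_i\in[d_i]}\psi_{p_i'}(\partial_{i,j_i}f(\mathbf x))\,\partial_{i,j_i}\partial_{k,j_k}f(\mathbf x)\big)$ (this does not depend on $\mathbf x_i$). Weak irreducibility: let $G(f)$ be the undirected graph on vertices $V=\bigcup_{k\in[m]}\{k\}\times[d_k]$ where $(k,j_k),(l,j_l)$ with $k\ne l$ are adjacent iff there exist $j_\nu\in[d_\nu]$, $\nu\notin\{k,l\}$, with $f_{j_1,\ldots,j_m}>0$; $f\ge0$ is weakly irreducible if $G(f)$ is connected. Irreducibility: $f\ge0$ is irreducible if for every nonempty proper $J\subsetneq V$, with $I=V\setminus J$, there exist $(k,j_k)\in J$ and $(l,j_l)\in I$ for all $l\in[m]\setminus\{k\}$ with $f_{j_1,\ldots,j_m}>0$. *)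

theory Defs
  imports "HOL-Analysis.Analysis"
begin

text \<open>Conventions: modes are indexed by k < m (0-based), entries of mode k by j < d k.
  A tensor is a real function on index tuples J in idx m d; a point of R^d is
  a function x :: nat => nat => real, x k j being the j-th entry of x_k.\<close>

definition idx :: "nat \<Rightarrow> (nat \<Rightarrow> nat) \<Rightarrow> (nat \<Rightarrow> nat) set" where
  "idx m d = PiE {..<m} (\<lambda>k. {..<d k})"

definition mlf :: "nat \<Rightarrow> (nat \<Rightarrow> nat) \<Rightarrow> ((nat \<Rightarrow> nat) \<Rightarrow> real) \<Rightarrow> (nat \<Rightarrow> nat \<Rightarrow> real) \<Rightarrow> real" where
  "mlf m d f x = (\<Sum>J\<in>idx m d. f J * (\<Prod>k<m. x k (J k)))"

definition lpnorm :: "nat \<Rightarrow> real \<Rightarrow> (nat \<Rightarrow> real) \<Rightarrow> real" where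
  "lpnorm n q v = (\<Sum>j<n. \<bar>v j\<bar> powr q) powr (1 / q)"

definition Qf :: "nat \<Rightarrow> (nat \<Rightarrow> nat) \<Rightarrow> (nat \<Rightarrow> real) \<Rightarrow> ((nat \<Rightarrow> nat) \<Rightarrow> real) \<Rightarrow> (nat \<Rightarrow> nat \<Rightarrow> real) \<Rightarrow> real" where
  "Qf m d p f x = \<bar>mlf m d f x\<bar> / (\<Prod>k<m. lpnorm (d k) (p k) (x k))"

definition admissible :: "nat \<Rightarrow> (nat \<Rightarrow> nat) \<Rightarrow> (nat \<Rightarrow> nat \<Rightarrow> real) \<Rightarrow> bool" where
  "admissible m d x = (\<forall>k<m. \<exists>j<d k. x k j \<noteq> 0)"

definition tnorm :: "nat \<Rightarrow> (nat \<Rightarrow> nat) \<Rightarrow> (nat \<Rightarrow> real) \<Rightarrow> ((nat \<Rightarrow> nat) \<Rightarrow> real) \<Rightarrow> real" where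
  "tnorm m d p f = Sup (Qf m d p f ` {x. admissible m d x})"

definition upd :: "(nat \<Rightarrow> nat \<Rightarrow> real) \<Rightarrow> nat \<Rightarrow> nat \<Rightarrow> real \<Rightarrow> (nat \<Rightarrow> nat \<Rightarrow> real)" where
  "upd x k j t = x(k := (x k)(j := t))"

definition tpartial :: "nat \<Rightarrow> nat \<Rightarrow> ((nat \<Rightarrow> nat \<Rightarrow> real) \<Rightarrow> real) \<Rightarrow> (nat \<Rightarrow> nat \<Rightarrow> real) \<Rightarrow> real" where
  "tpartial k j g x = deriv (\<lambda>t. g (upd x k j t)) (x k j)"

definition psi :: "real \<Rightarrow> real \<Rightarrow> real" where
  "psi q y = sgn y * \<bar>y\<bar> powr (q - 1)"

definition conj_exp :: "real \<Rightarrow> real" where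
  "conj_exp q = q / (q - 1)"

definition sfun :: "nat \<Rightarrow> (nat \<Rightarrow> nat) \<Rightarrow> (nat \<Rightarrow> real) \<Rightarrow> ((nat \<Rightarrow> nat) \<Rightarrow> real) \<Rightarrow> nat \<Rightarrow> nat \<Rightarrow> nat \<Rightarrow> (nat \<Rightarrow> nat \<Rightarrow> real) \<Rightarrow> real" where
  "sfun m d p f i k j x = psi (conj_exp (p k))
     (\<Sum>ji<d i. psi (conj_exp (p i)) (tpartial i ji (mlf m d f) x)
                 * tpartial i ji (tpartial k j (mlf m d f)) x)"

text \<open>S^d_{++}; vectors are taken extensional (zero outside the index range)\<close>
definition Spp :: "nat \<Rightarrow> (nat \<Rightarrow> nat) \<Rightarrow> (nat \<Rightarrow> real) \<Rightarrow> (nat \<Rightarrow> nat \<Rightarrow> real) set" where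
  "Spp m d p = {x. (\<forall>k j. k < m \<and> j < d k \<longrightarrow> x k j > 0)
                  \<and> (\<forall>k j. \<not> (k < m \<and> j < d k) \<longrightarrow> x k j = 0)
                  \<and> (\<forall>k<m. lpnorm (d k) (p k) (x k) = 1)}"

definition nonneg_tensor :: "nat \<Rightarrow> (nat \<Rightarrow> nat) \<Rightarrow> ((nat \<Rightarrow> nat) \<Rightarrow> real) \<Rightarrow> bool" where
  "nonneg_tensor m d f = (\<forall>J\<in>idx m d. f J \<ge> 0)"

definition vertices :: "nat \<Rightarrow> (nat \<Rightarrow> nat) \<Rightarrow> (nat \<times> nat) set" where
  "vertices m d = {(k, j). k < m \<and> j < d k}"

definition gadj :: "nat \<Rightarrow> (nat \<Rightarrow> nat) \<Rightarrow> ((nat \<Rightarrow> nat) \<Rightarrow> real) \<Rightarrow> nat \<times> nat \<Rightarrow> nat \<times> nat \<Rightarrow> bool" where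
  "gadj m d f u v = (fst u \<noteq> fst v \<and> u \<in> vertices m d \<and> v \<in> vertices m d \<and>
      (\<exists>J\<in>idx m d. J (fst u) = snd u \<and> J (fst v) = snd v \<and> f J > 0))"

definition weakly_irreducible :: "nat \<Rightarrow> (nat \<Rightarrow> nat) \<Rightarrow> ((nat \<Rightarrow> nat) \<Rightarrow> real) \<Rightarrow> bool" where
  "weakly_irreducible m d f = (nonneg_tensor m d f \<and>
     (\<forall>u\<in>vertices m d. \<forall>v\<in>vertices m d. (gadj m d f)\<^sup>*\<^sup>* u v))"

definition irreducible_tensor :: "nat \<Rightarrow> (nat \<Rightarrow> nat) \<Rightarrow> ((nat \<Rightarrow> nat) \<Rightarrow> real) \<Rightarrow> bool" where
  "irreducible_tensor m d f = (nonneg_tensor m d f \<and>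
     (\<forall>Jset. Jset \<subseteq> vertices m d \<longrightarrow> Jset \<noteq> {} \<longrightarrow> Jset \<noteq> vertices m d \<longrightarrow>
        (\<exists>(k, jk)\<in>Jset. \<exists>J\<in>idx m d. J k = jk \<and>
            (\<forall>l<m. l \<noteq> k \<longrightarrow> (l, J l) \<in> vertices m d - Jset) \<and> f J > 0)))"

definition singular_vector :: "nat \<Rightarrow> (nat \<Rightarrow> nat) \<Rightarrow> (nat \<Rightarrow> real) \<Rightarrow> ((nat \<Rightarrow> nat) \<Rightarrow> real) \<Rightarrow> (nat \<Rightarrow> nat \<Rightarrow> real) \<Rightarrow> bool" where
  "singular_vector m d p f x = (admissible m d x \<and> mlf m d f x \<noteq> 0 \<and>
     (\<forall>k<m. \<forall>j<d k. ((\<lambda>t. Qf m d p f (upd x k j t)) has_real_derivative 0) (at (x k j))))"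

end

theory Submission
  imports Defs
begin

text \<open>
  The hypothesis on the exponents says $p_k \ge (m-1)\,p_i'$ for all $k \ne i$, and therefore
  $\sum_k 1/p_k \le 1$. In the variables $u_{k,j} = x_{k,j}^{p_k}$ the form $f$ is then a nonnegative
  combination of concave monomials $\prod_k u_{k,j_k}^{1/p_k}$ on a product of simplices. Comparing the
  values of $f$ at two positive points $w$, $z$ term by term through the weighted AM-GM inequality for the
  ratios $(w_{k,j}/z_{k,j})^{p_k}$ bounds $f(w)$ in terms of the partial derivatives at $z$: this gives
  the minimax bound and, by the equality case of AM-GM and the connectedness of $G(f)$, the uniqueness of
  positive critical points. A maximizer exists by compactness and is positive since
  the exponents of the monomials in a proper subset of the modes add up to less than $1$. For the minimax
  identities $x_i$ is replaced by its optimal value $\psi_{p_i'}(\nabla_i f(x))$.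
\<close>

section \<open>Multilinear forms and their partial derivatives\<close>

text \<open>The exponent q (m - 1), with q the conjugate of p_i, comes from the lifted point, where
  x_i has been replaced. If F is the value of f there, then F is also the p_i-th power of the norm
  of the new block, so Q equals F^(1/q) there and F <= ||f||^q. In each of the m - 1 other modes F
  is the mean of the quotients with weights x_{k,j}^{p_k}; hence every minimum is at most F, which
  bounds the max-min side. On the min-max side every maximum L_k is at least F, but F itself may lie
  below ||f||^q, so a comparison with a maximizer is necessary. AM-GM yields ||f|| <= F^(1/q) times
  the product over k different from i of (L_k / F)^(1/p_k), with exponents that differ from mode to
  mode. Since L_k / F >= 1 and p_k >= (m - 1) q, each exponent may be raised to 1 / ((m - 1) q), and
  the m - 1 factors then cancel the powers of F exactly. Thus existence and uniqueness rest on the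
  sum condition, the min-max value on the bound for each single p_k.\<close>

definition slice :: "((nat \<Rightarrow> nat) \<Rightarrow> real) \<Rightarrow> nat \<Rightarrow> nat \<Rightarrow> (nat \<Rightarrow> nat) \<Rightarrow> real" where
  "slice f k j = (\<lambda>J. if J k = j then f J else 0)"

text \<open>The sliced tensor keeps all m modes, and the freed mode is fed with the all-ones vector.
  A partial derivative is thus again an \<open>mlf\<close>, so that second derivatives, scaling and
  positivity follow from the lemmas on \<open>mlf\<close>.\<close>

definition pd :: "nat \<Rightarrow> (nat \<Rightarrow> nat) \<Rightarrow> ((nat \<Rightarrow> nat) \<Rightarrow> real) \<Rightarrow> nat \<Rightarrow> nat \<Rightarrow> (nat \<Rightarrow> nat \<Rightarrow> real) \<Rightarrow> real" where
  "pd m d f k j x = mlf m d (slice f k j) (x(k := \<lambda>_. 1))"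

lemma finite_idx [simp]: "finite (idx m d)"
  by (simp add: idx_def finite_PiE)

lemma idx_less: "J \<in> idx m d \<Longrightarrow> k < m \<Longrightarrow> J k < d k"
  by (auto simp: idx_def PiE_def Pi_def)

lemma mlf_cong:
  assumes "\<And>k j. k < m \<Longrightarrow> j < d k \<Longrightarrow> x k j = y k j"
  shows "mlf m d f x = mlf m d f y"
  unfolding mlf_def
  by (intro sum.cong prod.cong arg_cong2[where f="(*)"] refl) (auto simp: assms idx_less)

lemma prod_fun_upd_const_one:
  assumes "k < (m::nat)"
  shows "(\<Prod>l<m. (x(k := \<lambda>_. 1)) l (J l)) = (\<Prod>l\<in>{..<m}-{k}. (x l (J l) :: real))"
proof -
  have "(\<Prod>l<m. (x(k := \<lambda>_. 1)) l (J l)) = (\<Prod>l\<in>{..<m}-{k}. (x(k := \<lambda>_. 1)) l (J l))"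
    using assms by (subst prod.remove[of _ k]) auto
  also have "\<dots> = (\<Prod>l\<in>{..<m}-{k}. x l (J l))"
    by (intro prod.cong) auto
  finally show ?thesis .
qed

text \<open>Euler's identity in one mode: each entry J contributes to exactly one slice, the one
  with j = J k.\<close>

lemma mlf_expand:
  assumes "k < m"
  shows "mlf m d f x = (\<Sum>j<d k. x k j * pd m d f k j x)"
proof -
  have "(\<Sum>j<d k. x k j * pd m d f k j x)
      = (\<Sum>J\<in>idx m d. \<Sum>j<d k. x k j * (slice f k j J * (\<Prod>l<m. (x(k := \<lambda>_. 1)) l (J l))))"
    unfolding pd_def mlf_def sum_distrib_left by (rule sum.swap)
  also have "\<dots> = (\<Sum>J\<in>idx m d. f J * (\<Prod>l<m. x l (J l)))"
  proof (rule sum.cong[OF refl])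
    fix J assume J: "J \<in> idx m d"
    define P where "P = (\<Prod>l\<in>{..<m}-{k}. x l (J l))"
    have "(\<Sum>j<d k. x k j * (slice f k j J * (\<Prod>l<m. (x(k := \<lambda>_. 1)) l (J l))))
        = (\<Sum>j<d k. if j = J k then x k j * (f J * P) else 0)"
      unfolding prod_fun_upd_const_one[OF assms] P_def slice_def
      by (intro sum.cong) auto
    also have "\<dots> = x k (J k) * (f J * P)"
      using idx_less[OF J assms] by (simp add: sum.delta)
    also have "\<dots> = f J * (\<Prod>l<m. x l (J l))"
      using assms unfolding P_def by (subst prod.remove[of "{..<m}" k]) auto
    finally show "(\<Sum>j<d k. x k j * (slice f k j J * (\<Prod>l<m. (x(k := \<lambda>_. 1)) l (J l))))
        = f J * (\<Prod>l<m. x l (J l))" .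
  qed
  finally show ?thesis unfolding mlf_def by simp
qed

lemma pd_fun_upd_same [simp]: "pd m d f k j (x(k := v)) = pd m d f k j x"
  by (simp add: pd_def)

section \<open>Linearity in a single mode and its consequences for derivatives\<close>

lemma mlf_fun_upd:
  assumes "k < m"
  shows "mlf m d f (x(k := v)) = (\<Sum>j<d k. v j * pd m d f k j x)"
  using mlf_expand[OF assms, of d f "x(k := v)"] by simp

lemma mlf_scale:
  assumes "k < m"
  shows "mlf m d f (x(k := \<lambda>j. c * x k j)) = c * mlf m d f x"
  using assms by (simp add: mlf_fun_upd mlf_expand[of k m d f x] sum_distrib_left mult.assoc)

lemma pd_scale:
  assumes "i < m" "i \<noteq> k"
  shows "pd m d f k j (x(i := \<lambda>j. c * x i j)) = c * pd m d f k j x"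
  using mlf_scale[OF assms(1), of d "slice f k j" "x(k := \<lambda>_. 1)" c] assms(2)
  by (simp add: pd_def fun_upd_twist)

lemma mlf_upd:
  assumes "k < m" "j < d k"
  shows "mlf m d f (upd x k j t) = mlf m d f x + (t - x k j) * pd m d f k j x"
proof -
  have "mlf m d f (upd x k j t) = (\<Sum>j'<d k. ((x k)(j := t)) j' * pd m d f k j' x)"
    unfolding upd_def by (rule mlf_fun_upd[OF assms(1)])
  also have "\<dots> = (\<Sum>j'<d k. x k j' * pd m d f k j' x + (if j' = j then (t - x k j) * pd m d f k j' x else 0))"
    by (intro sum.cong) (auto simp: algebra_simps)
  also have "\<dots> = mlf m d f x + (t - x k j) * pd m d f k j x"
    using assms by (simp add: sum.distrib mlf_expand[of k m d f x])
  finally show ?thesis .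
qed

lemma has_derivative_mlf_upd:
  assumes "k < m" "j < d k"
  shows "((\<lambda>t. mlf m d f (upd x k j t)) has_real_derivative pd m d f k j x) (at s)"
  unfolding mlf_upd[of k m j d, OF assms] by (auto intro!: derivative_eq_intros)

lemma tpartial_mlf:
  assumes "k < m" "j < d k"
  shows "tpartial k j (mlf m d f) x = pd m d f k j x"
  unfolding tpartial_def by (rule DERIV_imp_deriv[OF has_derivative_mlf_upd[of k m j d, OF assms]])

lemma tpartial_tpartial_mlf:
  assumes "k < m" "j < d k" "i < m" "i \<noteq> k" "ji < d i"
  shows "tpartial i ji (tpartial k j (mlf m d f)) x = pd m d (slice f k j) i ji (x(k := \<lambda>_. 1))"
proof -
  have "(upd x i ji t)(k := \<lambda>_. 1) = upd (x(k := \<lambda>_. 1)) i ji t" for t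
    using assms(4) by (auto simp: upd_def fun_upd_twist)
  then have "tpartial i ji (tpartial k j (mlf m d f)) x = tpartial i ji (mlf m d (slice f k j)) (x(k := \<lambda>_. 1))"
    using assms(4) by (simp add: tpartial_def[of i] tpartial_mlf[of k m j d, OF assms(1,2)] pd_def)
  then show ?thesis by (simp add: tpartial_mlf assms)
qed

text \<open>This evaluates the inner sum of \<open>sfun\<close>: the derivative in (k, j) is linear
  in x_i, so contracting its mode-i gradient with v amounts to substituting v for x_i.\<close>

lemma sum_tpartial_tpartial_mlf:
  assumes "k < m" "j < d k" "i < m" "i \<noteq> k"
  shows "(\<Sum>ji<d i. v ji * tpartial i ji (tpartial k j (mlf m d f)) x) = pd m d f k j (x(i := v))"
proof -
  have "(\<Sum>ji<d i. v ji * tpartial i ji (tpartial k j (mlf m d f)) x)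
      = (\<Sum>ji<d i. v ji * pd m d (slice f k j) i ji (x(k := \<lambda>_. 1)))"
    by (intro sum.cong) (simp_all add: tpartial_tpartial_mlf assms)
  also have "\<dots> = pd m d f k j (x(i := v))"
    using assms by (simp add: pd_def[of _ _ f] mlf_fun_upd[symmetric] fun_upd_twist)
  finally show ?thesis .
qed

lemma mlf_pos:
  assumes "nonneg_tensor m d f" "J \<in> idx m d" "f J > 0"
    and "\<And>k j. k < m \<Longrightarrow> j < d k \<Longrightarrow> 0 \<le> x k j" "\<And>k. k < m \<Longrightarrow> 0 < x k (J k)"
  shows "mlf m d f x > 0"
  unfolding mlf_def
proof (rule sum_pos2[OF finite_idx assms(2)])
  show "0 < f J * (\<Prod>k<m. x k (J k))"
    using assms by (auto intro!: mult_pos_pos prod_pos)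
  show "0 \<le> f I * (\<Prod>k<m. x k (I k))" if "I \<in> idx m d" for I
    using assms that by (auto intro!: mult_nonneg_nonneg prod_nonneg simp: nonneg_tensor_def idx_less)
qed

text \<open>Positivity is asked only in the modes other than k, so the lemma applies where x k j =
  0, as in \<open>nonneg_singular_vector_positive\<close>.\<close>

lemma pd_pos:
  assumes "nonneg_tensor m d f" "J \<in> idx m d" "f J > 0" "J k = j"
    and "\<And>l j. l < m \<Longrightarrow> l \<noteq> k \<Longrightarrow> j < d l \<Longrightarrow> 0 \<le> x l j" "\<And>l. l < m \<Longrightarrow> l \<noteq> k \<Longrightarrow> 0 < x l (J l)"
  shows "pd m d f k j x > 0"
  unfolding pd_def
  by (rule mlf_pos[of _ _ _ J]) (use assms in \<open>auto simp: slice_def nonneg_tensor_def\<close>)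

text \<open>The missing weight 1 - sum a sits on an additional variable equal to 1, so S is a full
  weighted mean. The function \<open>gap\<close> is the defect in ln u <= u - 1 at u = t / S. In its
  weighted sum the linear parts cancel, because S is the mean, and ln S - ln P remains. Equality
  makes every gap of positive weight vanish, and \<open>gap\<close> vanishes only at t = S.\<close>

lemma weighted_amgm:
  fixes a r :: "'a \<Rightarrow> real"
  assumes "finite K" "\<And>k. k \<in> K \<Longrightarrow> 0 < a k" "sum a K \<le> 1" "\<And>k. k \<in> K \<Longrightarrow> 0 < r k"
  defines "S \<equiv> (\<Sum>k\<in>K. a k * r k) + (1 - sum a K)"
  shows weighted_amgm_le: "(\<Prod>k\<in>K. r k powr a k) \<le> S"
    and weighted_amgm_eq: "(\<Prod>k\<in>K. r k powr a k) = S \<Longrightarrow> k \<in> K \<Longrightarrow> r k = S"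
proof -
  have S: "S > 0"
  proof (cases "K = {}")
    case False
    then have "(\<Sum>k\<in>K. a k * r k) > 0" using assms by (intro sum_pos) auto
    then show ?thesis using assms(3) unfolding S_def by linarith
  qed (simp add: S_def)
  define gap where "gap = (\<lambda>t::real. t / S - 1 - ln (t / S))"
  have gap: "gap t \<ge> 0" if "t > 0" for t
    using ln_le_minus_one[of "t / S"] that S by (simp add: gap_def)
  define P where "P = (\<Prod>k\<in>K. r k powr a k)"
  have P: "P > 0" unfolding P_def using assms(4) by (intro prod_pos) force
  have lnP: "ln P = (\<Sum>k\<in>K. a k * ln (r k))"
    unfolding P_def using assms by (subst ln_prod) (force simp: ln_powr intro!: sum.cong)+
  have g1: "gap 1 = 1 / S - 1 + ln S" using S by (simp add: gap_def ln_div)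
  have "(\<Sum>k\<in>K. a k * gap (r k)) = (\<Sum>k\<in>K. a k * r k / S - a k - a k * ln (r k) + a k * ln S)"
    using S less_imp_neq[OF assms(4), symmetric]
    by (intro sum.cong) (simp_all add: gap_def ln_div algebra_simps)
  also have "\<dots> = (\<Sum>k\<in>K. a k * r k) / S - sum a K - ln P + sum a K * ln S"
    by (simp add: sum.distrib sum_subtractf sum_divide_distrib sum_distrib_right lnP)
  finally have sum_gap: "(\<Sum>k\<in>K. a k * gap (r k)) + (1 - sum a K) * gap 1 = ln S - ln P"
  proof -
    assume e: "(\<Sum>k\<in>K. a k * gap (r k)) = (\<Sum>k\<in>K. a k * r k) / S - sum a K - ln P + sum a K * ln S"
    have "((\<Sum>k\<in>K. a k * r k) + (1 - sum a K)) / S = 1" using S unfolding S_def by simp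
    then have "(\<Sum>k\<in>K. a k * r k) / S + (1 - sum a K) * (1 / S) = 1" by (simp add: add_divide_distrib)
    then show ?thesis unfolding e g1 by (simp add: algebra_simps)
  qed
  have nn: "(\<Sum>k\<in>K. a k * gap (r k)) \<ge> 0" "(1 - sum a K) * gap 1 \<ge> 0"
    using assms gap by (auto intro!: sum_nonneg mult_nonneg_nonneg simp: less_imp_le)
  then have "ln P \<le> ln S" using sum_gap by linarith
  then show "(\<Prod>k\<in>K. r k powr a k) \<le> S" using P S unfolding P_def[symmetric] by simp
  assume "(\<Prod>k\<in>K. r k powr a k) = S" and k: "k \<in> K"
  then have "P = S" by (simp add: P_def)
  then have "(\<Sum>k\<in>K. a k * gap (r k)) = 0" using sum_gap nn by auto
  then have "a k * gap (r k) = 0"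
    using assms gap k by (subst (asm) sum_nonneg_eq_0_iff) (auto simp: less_imp_le)
  then have "ln (r k / S) = r k / S - 1" using assms(2)[OF k] by (simp add: gap_def)
  then have "r k / S = 1" using ln_eq_minus_one[of "r k / S"] assms(4)[OF k] S by simp
  then show "r k = S" using S by simp
qed

section \<open>Comparison of values by AM-GM\<close>

lemma lpnorm_powr:
  assumes "q > 0"
  shows "lpnorm n q v powr q = (\<Sum>j<n. \<bar>v j\<bar> powr q)"
  using assms by (simp add: lpnorm_def powr_powr sum_nonneg)

lemma lpnorm_eq_1_iff:
  assumes "q > 0"
  shows "lpnorm n q v = 1 \<longleftrightarrow> (\<Sum>j<n. \<bar>v j\<bar> powr q) = 1"
proof
  assume "lpnorm n q v = 1"
  then show "(\<Sum>j<n. \<bar>v j\<bar> powr q) = 1" using lpnorm_powr[OF assms, of n v] by simp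
qed (simp add: lpnorm_def)

lemma sum_abs_powr_pos:
  fixes v :: "nat \<Rightarrow> real"
  assumes "j < n" "v j \<noteq> 0"
  shows "0 < (\<Sum>j<n. \<bar>v j\<bar> powr q)"
  by (rule sum_pos2[of _ j]) (use assms in auto)

lemma lpnorm_pos:
  assumes "j < n" "v j \<noteq> 0"
  shows "0 < lpnorm n q v"
  using sum_abs_powr_pos[of j n v q, OF assms] by (simp add: lpnorm_def)

lemma lpnorm_normalized:
  assumes "q > 0" "j < n" "v j \<noteq> 0"
  shows "lpnorm n q (\<lambda>j. v j / lpnorm n q v) = 1"
proof -
  have N: "lpnorm n q v > 0" by (rule lpnorm_pos[of j n v, OF assms(2,3)])
  have "(\<Sum>j<n. \<bar>v j / lpnorm n q v\<bar> powr q) = (\<Sum>j<n. \<bar>v j\<bar> powr q / lpnorm n q v powr q)"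
    using N by (intro sum.cong) (auto simp: powr_divide)
  also have "\<dots> = 1"
    using sum_abs_powr_pos[of j n v q, OF assms(2,3)] by (simp add: sum_divide_distrib[symmetric] lpnorm_powr[OF assms(1)])
  finally show ?thesis by (simp add: lpnorm_eq_1_iff[OF assms(1)])
qed

lemma lpnorm_cong: "(\<And>j. j < n \<Longrightarrow> \<bar>v j\<bar> = \<bar>w j\<bar>) \<Longrightarrow> lpnorm n q v = lpnorm n q w"
  unfolding lpnorm_def by (intro arg_cong2[where f="(powr)"] sum.cong) auto

text \<open>The point \<open>z\<close> carries the information on partial derivatives;
  \<open>w\<close> is the competitor.\<close>

locale tensor_amgm =
  fixes m :: nat and d :: "nat \<Rightarrow> nat" and p :: "nat \<Rightarrow> real" and f :: "(nat \<Rightarrow> nat) \<Rightarrow> real"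
    and z w :: "nat \<Rightarrow> nat \<Rightarrow> real"
  assumes nonneg: "nonneg_tensor m d f"
    and p_pos: "\<And>k. k < m \<Longrightarrow> 0 < p k"
    and sum_p: "(\<Sum>k<m. 1 / p k) \<le> 1"
    and z_pos: "\<And>k j. k < m \<Longrightarrow> j < d k \<Longrightarrow> 0 < z k j"
    and w_pos: "\<And>k j. k < m \<Longrightarrow> j < d k \<Longrightarrow> 0 < w k j"
begin

text \<open>The quotient of the two points in the coordinates u = x^p. Since w is z times the p-th
  root of the ratio, a monomial of f(w) is the same monomial of f(z) times a weighted geometric mean
  of ratios.\<close>

definition ratio :: "nat \<Rightarrow> nat \<Rightarrow> real" where
  "ratio k j = (w k j / z k j) powr p k"

lemma ratio_pos: "k < m \<Longrightarrow> j < d k \<Longrightarrow> 0 < ratio k j"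
  using z_pos[of k j] w_pos[of k j] by (simp add: ratio_def)

text \<open>The AM-GM bound for one monomial after the ratios of mode k have been multiplied by a
  free factor \<open>c k\<close>. The factors compensate for multipliers that differ between modes;
  in the equality case they are all 1.\<close>

definition term_bound :: "(nat \<Rightarrow> real) \<Rightarrow> (nat \<Rightarrow> nat) \<Rightarrow> real" where
  "term_bound c J = f J * (\<Prod>k<m. z k (J k)) *
     ((\<Sum>k<m. 1 / p k * (c k * ratio k (J k))) + (1 - (\<Sum>k<m. 1 / p k)))"

lemma term_eq:
  assumes "J \<in> idx m d" "\<And>k. k < m \<Longrightarrow> 0 < c k"
  shows "f J * (\<Prod>k<m. w k (J k)) * (\<Prod>k<m. c k powr (1 / p k))
       = f J * (\<Prod>k<m. z k (J k)) * (\<Prod>k<m. (c k * ratio k (J k)) powr (1 / p k))"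
proof -
  have "(\<Prod>k<m. w k (J k)) * (\<Prod>k<m. c k powr (1 / p k))
      = (\<Prod>k<m. z k (J k) * (c k * ratio k (J k)) powr (1 / p k))"
    unfolding prod.distrib[symmetric]
  proof (rule prod.cong[OF refl])
    fix k assume k: "k \<in> {..<m}"
    then have *: "0 < z k (J k)" "0 < w k (J k)" "0 < p k" "0 < c k"
      using z_pos w_pos p_pos assms idx_less by auto
    then have "ratio k (J k) powr (1 / p k) = w k (J k) / z k (J k)"
      by (simp add: ratio_def powr_powr)
    with * show "w k (J k) * c k powr (1 / p k) = z k (J k) * (c k * ratio k (J k)) powr (1 / p k)"
      by (simp add: powr_mult ratio_def)
  qed
  then show ?thesis by (simp add: prod.distrib mult.assoc)
qed

lemma term_le:
  assumes "J \<in> idx m d" "\<And>k. k < m \<Longrightarrow> 0 < c k"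
  shows "f J * (\<Prod>k<m. w k (J k)) * (\<Prod>k<m. c k powr (1 / p k)) \<le> term_bound c J"
proof -
  have "(\<Prod>k<m. (c k * ratio k (J k)) powr (1 / p k))
      \<le> (\<Sum>k<m. 1 / p k * (c k * ratio k (J k))) + (1 - (\<Sum>k<m. 1 / p k))"
    using p_pos assms sum_p by (intro weighted_amgm_le) (auto intro!: mult_pos_pos ratio_pos simp: idx_less)
  moreover have "0 \<le> f J * (\<Prod>k<m. z k (J k))"
    using nonneg assms by (auto intro!: mult_nonneg_nonneg prod_nonneg less_imp_le[OF z_pos] simp: nonneg_tensor_def idx_less)
  moreover have "f J * (\<Prod>k<m. w k (J k)) * (\<Prod>k<m. c k powr (1 / p k))
       = f J * (\<Prod>k<m. z k (J k)) * (\<Prod>k<m. (c k * ratio k (J k)) powr (1 / p k))"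
    using assms by (rule term_eq)
  ultimately show ?thesis unfolding term_bound_def by (simp only: mult_left_mono)
qed

text \<open>The factor \<open>ratio k (J k)\<close> depends on J through its k-th index alone, so it
  can be absorbed into block k of z.\<close>

lemma sum_term_bound:
  "(\<Sum>J\<in>idx m d. term_bound c J)
     = (\<Sum>k<m. 1 / p k * (c k * mlf m d f (z(k := \<lambda>j. ratio k j * z k j)))) + (1 - (\<Sum>k<m. 1 / p k)) * mlf m d f z"
proof -
  have 1: "(\<Prod>l<m. (z(k := \<lambda>j. ratio k j * z k j)) l (J l)) = ratio k (J k) * (\<Prod>l<m. z l (J l))"
    if "k < m" for k J
  proof -
    have "(\<Prod>l<m. (z(k := \<lambda>j. ratio k j * z k j)) l (J l))
        = ratio k (J k) * z k (J k) * (\<Prod>l\<in>{..<m}-{k}. (z(k := \<lambda>j. ratio k j * z k j)) l (J l))"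
      using that by (subst prod.remove[of _ k]) auto
    also have "(\<Prod>l\<in>{..<m}-{k}. (z(k := \<lambda>j. ratio k j * z k j)) l (J l)) = (\<Prod>l\<in>{..<m}-{k}. z l (J l))"
      by (intro prod.cong) auto
    finally show ?thesis using that by (simp add: prod.remove[of "{..<m}" k "\<lambda>l. z l (J l)"] mult.assoc)
  qed
  have 2: "(\<Sum>k<m. 1 / p k * (c k * mlf m d f (z(k := \<lambda>j. ratio k j * z k j))))
      = (\<Sum>J\<in>idx m d. \<Sum>k<m. 1 / p k * (c k * (f J * (ratio k (J k) * (\<Prod>l<m. z l (J l))))))"
    unfolding mlf_def sum_distrib_left
    by (subst sum.swap, intro sum.cong refl) (simp add: 1 del: fun_upd_apply)
  have 3: "(1 - (\<Sum>k<m. 1 / p k)) * mlf m d f z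
      = (\<Sum>J\<in>idx m d. (1 - (\<Sum>k<m. 1 / p k)) * (f J * (\<Prod>l<m. z l (J l))))"
    unfolding mlf_def sum_distrib_left ..
  show ?thesis
    unfolding 2 3 sum.distrib[symmetric]
    by (intro sum.cong refl) (simp add: term_bound_def algebra_simps sum_distrib_left sum_distrib_right)
qed

text \<open>The ratio times z^p is w^p, so the bounds on the derivatives at z add up to mu times the
  p-th power of the norm of w_k, which is 1.\<close>

lemma mlf_ratio_le:
  assumes "k < m" "\<And>j. j < d k \<Longrightarrow> z k j * pd m d f k j z \<le> \<mu> * z k j powr p k"
    and "lpnorm (d k) (p k) (w k) = 1"
  shows "mlf m d f (z(k := \<lambda>j. ratio k j * z k j)) \<le> \<mu>"
proof -
  have "mlf m d f (z(k := \<lambda>j. ratio k j * z k j)) = (\<Sum>j<d k. ratio k j * (z k j * pd m d f k j z))"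
    by (simp add: mlf_fun_upd[OF assms(1)] mult.assoc)
  also have "\<dots> \<le> (\<Sum>j<d k. ratio k j * (\<mu> * z k j powr p k))"
    using assms by (intro sum_mono mult_left_mono) (auto simp: ratio_def)
  also have "\<dots> = (\<Sum>j<d k. \<mu> * \<bar>w k j\<bar> powr p k)"
  proof (intro sum.cong refl)
    fix j assume "j \<in> {..<d k}"
    then have "0 < z k j" "0 < w k j" using z_pos w_pos assms by auto
    then show "ratio k j * (\<mu> * z k j powr p k) = \<mu> * \<bar>w k j\<bar> powr p k"
      by (simp add: ratio_def powr_divide)
  qed
  also have "\<dots> = \<mu>"
    using assms p_pos by (simp add: sum_distrib_left[symmetric] lpnorm_eq_1_iff)
  finally show ?thesis .
qed

text \<open>With $c_k = f(z)/\mu_k$ every summand of the AM-GM bound contributes at most its weight times $f(z)$.\<close>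

lemma mlf_le_of_subeigen:
  assumes "0 < mlf m d f z" "\<And>k. k < m \<Longrightarrow> 0 < \<mu> k"
    and "\<And>k j. k < m \<Longrightarrow> j < d k \<Longrightarrow> z k j * pd m d f k j z \<le> \<mu> k * z k j powr p k"
    and "\<And>k. k < m \<Longrightarrow> lpnorm (d k) (p k) (w k) = 1"
  shows "mlf m d f w \<le> mlf m d f z * (\<Prod>k<m. (\<mu> k / mlf m d f z) powr (1 / p k))"
proof -
  define F where "F = mlf m d f z"
  define c where "c k = F / \<mu> k" for k
  have c: "0 < c k" if "k < m" for k using assms that by (auto simp: F_def c_def)
  have F: "F > 0" using assms by (simp add: F_def)
  have "mlf m d f w * (\<Prod>k<m. c k powr (1 / p k)) \<le> (\<Sum>J\<in>idx m d. term_bound c J)"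
    unfolding mlf_def sum_distrib_right by (intro sum_mono term_le c)
  also have "\<dots> \<le> (\<Sum>k<m. 1 / p k * F) + (1 - (\<Sum>k<m. 1 / p k)) * F"
    unfolding sum_term_bound F_def[symmetric]
  proof (intro add_right_mono sum_mono mult_left_mono)
    fix k assume "k \<in> {..<m}"
    then have k: "k < m" by simp
    have "c k * mlf m d f (z(k := \<lambda>j. ratio k j * z k j)) \<le> c k * \<mu> k"
      using c[OF k] by (intro mult_left_mono mlf_ratio_le) (use assms k in auto)
    also have "\<dots> = F" using assms(2)[OF k] by (simp add: c_def)
    finally show "c k * mlf m d f (z(k := \<lambda>j. ratio k j * z k j)) \<le> F" .
    show "0 \<le> 1 / p k" using p_pos[OF k] by simp
  qed
  also have "\<dots> = F" by (simp only: sum_distrib_right[symmetric]) (simp add: algebra_simps)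
  finally have *: "mlf m d f w * (\<Prod>k<m. c k powr (1 / p k)) \<le> F" .
  have "(\<Prod>k<m. c k powr (1 / p k)) * (\<Prod>k<m. (\<mu> k / F) powr (1 / p k)) = (\<Prod>k<m. 1)"
    unfolding prod.distrib[symmetric] using F assms(2)
    by (intro prod.cong refl) (auto simp: c_def powr_mult[symmetric] less_imp_neq[symmetric])
  then have "mlf m d f w = mlf m d f w * (\<Prod>k<m. c k powr (1 / p k)) * (\<Prod>k<m. (\<mu> k / F) powr (1 / p k))"
    by (simp add: mult.assoc)
  also have "\<dots> \<le> F * (\<Prod>k<m. (\<mu> k / F) powr (1 / p k))"
    by (intro mult_right_mono * prod_nonneg) auto
  finally show ?thesis unfolding F_def .
qed

text \<open>With all c k = 1 the AM-GM bounds sum to at most f(z), hence to at most f(w). Each bound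
  dominates its own term of f(w), so all of them are equalities; for a positive entry the equality
  case of AM-GM makes its ratios coincide.\<close>

lemma ratio_eq_on_support:
  assumes eigen: "\<And>k j. k < m \<Longrightarrow> j < d k \<Longrightarrow> z k j * pd m d f k j z \<le> mlf m d f z * z k j powr p k"
    and w1: "\<And>k. k < m \<Longrightarrow> lpnorm (d k) (p k) (w k) = 1"
    and le: "mlf m d f z \<le> mlf m d f w"
    and J: "J \<in> idx m d" "f J > 0" and kl: "k < m" "l < m"
  shows "ratio k (J k) = ratio l (J l)"
proof -
  define c where "c = (\<lambda>k::nat. 1::real)"
  define gap where "gap I = term_bound c I - f I * (\<Prod>k<m. w k (I k))" for I
  have gap: "gap I \<ge> 0" if "I \<in> idx m d" for I
    using term_le[OF that, of c] by (simp add: gap_def c_def)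
  have "(\<Sum>I\<in>idx m d. term_bound c I) \<le> (\<Sum>k<m. 1 / p k * mlf m d f z) + (1 - (\<Sum>k<m. 1 / p k)) * mlf m d f z"
    unfolding sum_term_bound
  proof (intro add_right_mono sum_mono mult_left_mono)
    fix k assume "k \<in> {..<m}"
    then have k: "k < m" by simp
    show "c k * mlf m d f (z(k := \<lambda>j. ratio k j * z k j)) \<le> mlf m d f z"
      using mlf_ratio_le[OF k eigen[OF k] w1[OF k]] by (simp add: c_def)
    show "0 \<le> 1 / p k" using p_pos[OF k] by simp
  qed
  also have "\<dots> = mlf m d f z" by (simp only: sum_distrib_right[symmetric]) (simp add: algebra_simps)
  finally have "(\<Sum>I\<in>idx m d. gap I) \<le> 0" using le by (simp add: gap_def sum_subtractf mlf_def)
  then have "(\<Sum>I\<in>idx m d. gap I) = 0" using gap by (intro antisym sum_nonneg) auto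
  then have "gap J = 0" using gap J by (simp add: sum_nonneg_eq_0_iff)
  then have "f J * (\<Prod>k<m. z k (J k)) * (\<Prod>k<m. (c k * ratio k (J k)) powr (1 / p k)) = term_bound c J"
    using term_eq[OF J(1), of c, symmetric] by (simp add: gap_def c_def)
  moreover have "f J * (\<Prod>k<m. z k (J k)) \<noteq> 0"
    using J less_imp_neq[OF z_pos, symmetric] by (simp add: idx_less)
  ultimately have eq: "(\<Prod>k<m. ratio k (J k) powr (1 / p k))
      = (\<Sum>k<m. 1 / p k * ratio k (J k)) + (1 - (\<Sum>k<m. 1 / p k))"
    unfolding term_bound_def c_def mult_1 by (simp only: mult_cancel_left) blast
  have "ratio n (J n) = (\<Sum>k<m. 1 / p k * ratio k (J k)) + (1 - (\<Sum>k<m. 1 / p k))" if "n < m" for n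
    using p_pos J sum_p that
    by (intro weighted_amgm_eq[OF _ _ _ _ eq]) (auto intro!: ratio_pos simp: idx_less)
  from this[OF kl(1)] this[OF kl(2)] show ?thesis by simp
qed

end

section \<open>Existence and positivity of a maximizer\<close>

text \<open>The closed counterpart of \<open>Spp\<close>. Fixing the values outside the index range
  makes it compact in the product topology on functions.\<close>

definition Snn :: "nat \<Rightarrow> (nat \<Rightarrow> nat) \<Rightarrow> (nat \<Rightarrow> real) \<Rightarrow> (nat \<Rightarrow> nat \<Rightarrow> real) set" where
  "Snn m d p = {x. (\<forall>k j. k < m \<and> j < d k \<longrightarrow> x k j \<ge> 0)
                  \<and> (\<forall>k j. \<not> (k < m \<and> j < d k) \<longrightarrow> x k j = 0)
                  \<and> (\<forall>k<m. lpnorm (d k) (p k) (x k) = 1)}"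

section \<open>Compactness of the nonnegative normalized points\<close>

lemma compact_PiE_UNIV:
  fixes S :: "'i \<Rightarrow> 'a::topological_space set"
  assumes "\<And>i. compact (S i)"
  shows "compact (PiE UNIV S)"
  using compactin_PiE[of "\<lambda>i. euclidean" UNIV S] assms
  by (simp add: euclidean_product_topology compactin_euclidean_iff)

lemma continuous_on_entry [continuous_intros]:
  "continuous_on A (\<lambda>x. x k j :: 'a::topological_space)"
proof -
  have "continuous_on UNIV (\<lambda>x. x k j :: 'a)"
    by (rule continuous_on_product_then_coordinatewise[OF continuous_on_product_coordinates])
  then show ?thesis by (rule continuous_on_subset) simp
qed

lemma abs_le_one_of_lpnorm_eq_1:
  assumes "q > 0" "lpnorm n q v = 1" "j < n"
  shows "\<bar>v j\<bar> \<le> 1"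
proof (rule ccontr)
  assume "\<not> \<bar>v j\<bar> \<le> 1"
  then have "1 < \<bar>v j\<bar> powr q" using assms(1) by (simp add: gr_one_powr)
  also have "\<dots> \<le> (\<Sum>j<n. \<bar>v j\<bar> powr q)" using assms(3) by (intro member_le_sum) auto
  finally show False using assms by (simp add: lpnorm_eq_1_iff)
qed

text \<open>Normalized entries lie in [0, 1], so the set is a Tychonoff product of intervals and
  singletons, cut by the closed norm conditions.\<close>

lemma compact_Snn:
  assumes "\<And>k. k < m \<Longrightarrow> p k > 0"
  shows "compact (Snn m d p)"
proof -
  define T where "T k j = (if k < m \<and> j < d k then {0..1} else {0::real})" for k j
  define N where "N = (\<Inter>k\<in>{..<m}. {x::nat \<Rightarrow> nat \<Rightarrow> real. (\<Sum>j<d k. \<bar>x k j\<bar> powr p k) = 1})"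
  have "compact (PiE UNIV (\<lambda>k. PiE UNIV (T k)))"
    by (intro compact_PiE_UNIV) (simp add: T_def)
  moreover have "closed N"
    unfolding N_def
    using assms
    by (intro closed_INT ballI closed_Collect_eq continuous_on_sum continuous_on_powr' continuous_intros) auto
  ultimately have "compact (PiE UNIV (\<lambda>k. PiE UNIV (T k)) \<inter> N)" by (rule compact_Int_closed)
  also have "PiE UNIV (\<lambda>k. PiE UNIV (T k)) \<inter> N = Snn m d p"
  proof (intro set_eqI iffI)
    fix x assume x: "x \<in> Snn m d p"
    then have "x k j \<in> T k j" for k j
      using abs_le_one_of_lpnorm_eq_1[of "p k" "d k" "x k" j] assms[of k] by (auto simp: Snn_def T_def)
    then show "x \<in> PiE UNIV (\<lambda>k. PiE UNIV (T k)) \<inter> N"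
      using x assms by (auto simp: Snn_def N_def lpnorm_eq_1_iff)
  next
    fix x assume x: "x \<in> PiE UNIV (\<lambda>k. PiE UNIV (T k)) \<inter> N"
    then have T: "x k j \<in> T k j" for k j by (auto simp: PiE_def Pi_def)
    have "0 \<le> x k j" for k j using T[of k j] by (auto simp: T_def split: if_splits)
    moreover have "x k j = 0" if "\<not> (k < m \<and> j < d k)" for k j using T[of k j] that by (auto simp: T_def)
    ultimately show "x \<in> Snn m d p"
      using x assms by (auto simp: Snn_def N_def lpnorm_eq_1_iff)
  qed
  finally show ?thesis .
qed

lemma Snn_nonempty:
  assumes "\<And>k. k < m \<Longrightarrow> p k > 0" "\<And>k. k < m \<Longrightarrow> d k \<ge> 1"
  shows "Snn m d p \<noteq> {}"
proof -
  define x where "x k j = (if k < m \<and> j < d k then (1 / real (d k)) powr (1 / p k) else 0)" for k j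
  have "(\<Sum>j<d k. \<bar>x k j\<bar> powr p k) = 1" if "k < m" for k
  proof -
    have "(\<Sum>j<d k. \<bar>x k j\<bar> powr p k) = (\<Sum>j<d k. 1 / real (d k))"
      using assms(1)[OF that] assms(2)[OF that] that by (intro sum.cong) (auto simp: x_def powr_powr)
    then show ?thesis using assms(2)[OF that] by simp
  qed
  then have "x \<in> Snn m d p" using assms(1) by (auto simp: Snn_def lpnorm_eq_1_iff x_def)
  then show ?thesis by blast
qed

lemma mlf_attains_max_Snn:
  assumes "\<And>k. k < m \<Longrightarrow> p k > 0" "\<And>k. k < m \<Longrightarrow> d k \<ge> 1"
  shows "\<exists>x\<in>Snn m d p. \<forall>y\<in>Snn m d p. mlf m d f y \<le> mlf m d f x"
proof (rule continuous_attains_sup)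
  show "compact (Snn m d p)" "Snn m d p \<noteq> {}"
    using assms by (simp_all add: compact_Snn Snn_nonempty)
  show "continuous_on (Snn m d p) (mlf m d f)"
    unfolding mlf_def by (intro continuous_intros)
qed

text \<open>For nonnegative f, passing to absolute values keeps the norms and cannot decrease
  |f(x)|, so only nonnegative points compete for the norm.\<close>

lemma Qf_le_mlf_normalized:
  assumes "\<And>k. k < m \<Longrightarrow> p k > 0" "nonneg_tensor m d f" "admissible m d x"
  shows "\<exists>y\<in>Snn m d p. Qf m d p f x \<le> mlf m d f y"
proof
  define N where "N k = lpnorm (d k) (p k) (x k)" for k
  define y where "y k j = (if k < m \<and> j < d k then \<bar>x k j\<bar> / N k else 0)" for k j
  have N: "N k > 0" if "k < m" for k
    using assms(3) that lpnorm_pos unfolding N_def admissible_def by blast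
  have "lpnorm (d k) (p k) (y k) = 1" if k: "k < m" for k
  proof -
    from assms(3) k obtain j where j: "j < d k" "x k j \<noteq> 0" by (auto simp: admissible_def)
    have "lpnorm (d k) (p k) (y k) = lpnorm (d k) (p k) (\<lambda>j. x k j / N k)"
      using k by (intro lpnorm_cong) (simp add: y_def)
    also have "\<dots> = 1" unfolding N_def by (rule lpnorm_normalized[of _ _ _ "x k", OF assms(1)[OF k] j])
    finally show ?thesis .
  qed
  then show "y \<in> Snn m d p" using N by (auto simp: Snn_def y_def less_imp_le)
  have "\<bar>mlf m d f x\<bar> \<le> (\<Sum>J\<in>idx m d. \<bar>f J * (\<Prod>k<m. x k (J k))\<bar>)"
    unfolding mlf_def by (rule sum_abs)
  also have "\<dots> = (\<Sum>J\<in>idx m d. (\<Prod>k<m. N k) * (f J * (\<Prod>k<m. y k (J k))))"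
  proof (rule sum.cong[OF refl])
    fix J assume J: "J \<in> idx m d"
    have "(\<Prod>k<m. \<bar>x k (J k)\<bar>) = (\<Prod>k<m. N k * y k (J k))"
      using idx_less[OF J] N by (intro prod.cong) (auto simp: y_def less_imp_neq[symmetric])
    then show "\<bar>f J * (\<Prod>k<m. x k (J k))\<bar> = (\<Prod>k<m. N k) * (f J * (\<Prod>k<m. y k (J k)))"
      using J assms(2) by (simp add: abs_mult abs_prod prod.distrib nonneg_tensor_def)
  qed
  also have "\<dots> = (\<Prod>k<m. N k) * mlf m d f y" by (simp add: mlf_def sum_distrib_left)
  finally have "\<bar>mlf m d f x\<bar> \<le> (\<Prod>k<m. N k) * mlf m d f y" .
  moreover have "0 < (\<Prod>k<m. N k)" using N by (intro prod_pos) auto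
  ultimately show "Qf m d p f x \<le> mlf m d f y"
    by (simp add: Qf_def N_def[symmetric] pos_divide_le_eq mult.commute)
qed

lemma rtranclp_crossing:
  assumes "R\<^sup>*\<^sup>* a b" "P a" "\<not> P b"
  shows "\<exists>u v. R u v \<and> P u \<and> \<not> P v"
  using assms by (induction rule: rtranclp_induct) blast+

text \<open>In \<open>maximizer_pos\<close> the left side is the loss of a perturbation of size t,
  and the right side is the gain from one new monomial.\<close>

lemma no_sublinear_gain:
  fixes c F s :: real
  assumes "c > 0" "s < 1"
  shows "\<exists>t. 0 < t \<and> t < 1 \<and> t * F < c * t powr s"
proof (cases "F > 0")
  case False
  then have "1 / 2 * F < c * (1 / 2) powr s"
    using assms(1) by (intro le_less_trans[of "1 / 2 * F" 0]) auto
  then show ?thesis by (intro exI[of _ "1/2"]) auto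
next
  case True
  \<comment> \<open>\<open>b\<close> is the intended value of t^(1-s); the factors 1/2 make both b <
    1 and b F < c strict.\<close>
  define b where "b = min (1 / 2) (c / (2 * F))"
  define t where "t = b powr (1 / (1 - s))"
  have b: "0 < b" "b < 1" "b * F < c"
    using True assms(1) by (auto simp: b_def min_def field_simps)
  have t: "0 < t" "t < 1" using b assms(2) by (auto simp: t_def powr01_less_one)
  have "t powr (1 - s) = b" using b assms(2) by (simp add: t_def powr_powr)
  then have "t = b * t powr s" using t by (metis diff_add_cancel powr_add powr_one less_imp_le)
  moreover have "b * F * t powr s < c * t powr s" using b t by simp
  ultimately show ?thesis using t by (metis mult.assoc mult.commute)
qed

lemma weakly_irreducible_nonneg: "weakly_irreducible m d f \<Longrightarrow> nonneg_tensor m d f"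
  by (simp add: weakly_irreducible_def)

text \<open>Moving the $p$-th powers of a maximizer towards the uniform distribution by $t$ costs at most a
  factor $1 - t$, while a positive entry of $f$ joining a zero and a nonzero coordinate gains $t^s$ with
  $s < \sum_k 1/p_k \le 1$.\<close>

lemma maximizer_pos:
  assumes p: "\<And>k. k < m \<Longrightarrow> p k > 0" and d: "\<And>k. k < m \<Longrightarrow> d k \<ge> 1"
    and sum_p: "(\<Sum>k<m. 1 / p k) \<le> 1" and wi: "weakly_irreducible m d f"
    and x: "x \<in> Snn m d p" and max: "\<And>y. y \<in> Snn m d p \<Longrightarrow> mlf m d f y \<le> mlf m d f x"
    and kj: "k < m" "j < d k"
  shows "0 < x k j"
proof (rule ccontr)
  assume "\<not> 0 < x k j"
  moreover have x0: "0 \<le> x k j" for k j using x unfolding Snn_def by (cases "k < m \<and> j < d k") auto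
  ultimately have "x k j = 0" by (meson antisym not_less)
  have "\<exists>j'<d k. x k j' \<noteq> 0"
  proof (rule ccontr)
    assume "\<not> ?thesis"
    then have "lpnorm (d k) (p k) (x k) = 0" by (simp add: lpnorm_def)
    then show False using x kj by (simp add: Snn_def)
  qed
  then obtain j' where j': "j' < d k" "x k j' \<noteq> 0" by blast
  have "(gadj m d f)\<^sup>*\<^sup>* (k, j) (k, j')"
    using wi kj j' by (auto simp: weakly_irreducible_def vertices_def)
  \<comment> \<open>A path from a zero to a nonzero coordinate of block k has an edge where
    vanishing stops. The entry J behind this edge gives a monomial that vanishes at x although its
    coordinate in mode \<open>fst v\<close> does not.\<close>
  from rtranclp_crossing[OF this, of "\<lambda>v. x (fst v) (snd v) = 0"] \<open>x k j = 0\<close> j'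
  obtain u v where uv: "gadj m d f u v" "x (fst u) (snd u) = 0" "x (fst v) (snd v) \<noteq> 0" by auto
  then obtain J where J: "J \<in> idx m d" "f J > 0" "x (fst u) (J (fst u)) = 0" "x (fst v) (J (fst v)) \<noteq> 0"
    and um: "fst u < m" and vm: "fst v < m"
    by (auto simp: gadj_def vertices_def)
  define l where "l = fst v"
  have l: "l < m" "x l (J l) > 0" using J vm x0[of l "J l"] by (auto simp: l_def)
  \<comment> \<open>Lower bounds for the perturbed p-th powers along J: at least e n t for n
    different from l, but at least e l without the factor t, since a convex combination of x l (J
    l)^p and 1 / d l exceeds their minimum. This removes 1 / p l from the exponent of t and makes s
    < 1.\<close>
  define e where "e n = (if n = l then min (x l (J l) powr p l) (1 / real (d l)) else 1 / real (d n))" for n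
  have e: "0 < e n" if "n < m" for n using d[OF that] d[OF l(1)] l by (auto simp: e_def)
  define c where "c = f J * (\<Prod>n<m. e n powr (1 / p n))"
  define s where "s = (\<Sum>n\<in>{..<m}-{l}. 1 / p n)"
  have "c > 0" unfolding c_def using J less_imp_neq[OF e, symmetric] by (intro mult_pos_pos prod_pos) simp_all
  moreover have "s < 1"
  proof -
    have "(\<Sum>n<m. 1 / p n) = 1 / p l + s"
      unfolding s_def using l by (intro sum.remove) auto
    then show ?thesis using sum_p p[OF l(1)] by (smt (verit) zero_less_divide_1_iff)
  qed
  ultimately obtain t where t: "0 < t" "t < 1" "t * mlf m d f x < c * t powr s"
    using no_sublinear_gain by blast
  define U where "U n j = (1 - t) * x n j powr p n + t / real (d n)" for n j
  define W where "W n j = (if n < m \<and> j < d n then U n j powr (1 / p n) else 0)" for n j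
  have U: "0 \<le> U n j" for n j using t by (auto simp: U_def)
  have "W \<in> Snn m d p"
  proof -
    have "(\<Sum>j<d n. \<bar>W n j\<bar> powr p n) = 1" if n: "n < m" for n
    proof -
      have "(\<Sum>j<d n. \<bar>W n j\<bar> powr p n) = (\<Sum>j<d n. U n j)"
        using n p[OF n] U by (intro sum.cong) (auto simp: W_def powr_powr)
      also have "\<dots> = (1 - t) * (\<Sum>j<d n. x n j powr p n) + t"
        using d[OF n] by (simp add: U_def sum.distrib sum_distrib_left)
      also have "(\<Sum>j<d n. x n j powr p n) = 1"
        using x n x0 lpnorm_eq_1_iff[OF p[OF n], of "d n" "x n"] by (simp add: Snn_def)
      finally show ?thesis by simp
    qed
    then show ?thesis using p by (auto simp: Snn_def W_def lpnorm_eq_1_iff)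
  qed
  have W_old: "(1 - t) powr (1 / p n) * x n j \<le> W n j" if "n < m" "j < d n" for n j
  proof -
    have "(1 - t) powr (1 / p n) * x n j = ((1 - t) * x n j powr p n) powr (1 / p n)"
      using t p[OF that(1)] x0 by (simp add: powr_mult powr_powr)
    also have "\<dots> \<le> W n j"
      using that t p[OF that(1)] by (auto simp: W_def U_def intro!: powr_mono2)
    finally show ?thesis .
  qed
  have W_new: "e n powr (1 / p n) * (if n = l then 1 else t powr (1 / p n)) \<le> W n (J n)" if n: "n < m" for n
  proof (cases "n = l")
    case True
    have "e l = (1 - t) * e l + t * e l" by (simp add: algebra_simps)
    also have "\<dots> \<le> (1 - t) * x l (J l) powr p l + t * (1 / real (d l))"
      using t by (intro add_mono mult_left_mono) (auto simp: e_def)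
    finally have "e l \<le> U l (J l)" by (simp add: U_def)
    then show ?thesis using True n idx_less[OF J(1) n] e[OF n] p[OF n] by (auto simp: W_def intro!: powr_mono2)
  next
    case False
    have "e n * t \<le> U n (J n)" using t False by (simp add: U_def e_def)
    then have "(e n * t) powr (1 / p n) \<le> U n (J n) powr (1 / p n)"
      using e[OF n] p[OF n] t by (intro powr_mono2) auto
    then show ?thesis using False n idx_less[OF J(1) n] e[OF n] t by (simp add: W_def powr_mult)
  qed
  have fnn: "0 \<le> f I" if "I \<in> idx m d" for I
    using weakly_irreducible_nonneg[OF wi] that by (simp add: nonneg_tensor_def)
  have "c * t powr s \<le> f J * (\<Prod>n<m. W n (J n))"
  proof -
    have "(\<Prod>n<m. if n = l then 1 else t powr (1 / p n)) = (\<Prod>n\<in>{..<m}-{l}. t powr (1 / p n))"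
      using l by (subst prod.remove[of _ l]) (auto intro!: prod.cong)
    also have "\<dots> = t powr s" using t by (simp add: s_def powr_sum)
    finally have "c * t powr s = f J * (\<Prod>n<m. e n powr (1 / p n) * (if n = l then 1 else t powr (1 / p n)))"
      by (simp add: c_def prod.distrib)
    also have "\<dots> \<le> f J * (\<Prod>n<m. W n (J n))"
      using J W_new by (intro mult_left_mono prod_mono) auto
    finally show ?thesis .
  qed
  moreover have "(\<Sum>I\<in>idx m d - {J}. (1 - t) * (f I * (\<Prod>n<m. x n (I n))))
      \<le> (\<Sum>I\<in>idx m d - {J}. f I * (\<Prod>n<m. W n (I n)))"
  proof (rule sum_mono)
    fix I assume I: "I \<in> idx m d - {J}"
    \<comment> \<open>The base lies below 1, so an exponent of at most 1 costs no more than the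
      factor 1 - t.\<close>
    have "(1 - t) powr 1 \<le> (1 - t) powr (\<Sum>n<m. 1 / p n)"
      using t sum_p by (intro powr_mono') auto
    then have "(1 - t) * (\<Prod>n<m. x n (I n)) \<le> (1 - t) powr (\<Sum>n<m. 1 / p n) * (\<Prod>n<m. x n (I n))"
      using t x0 by (intro mult_right_mono prod_nonneg) auto
    also have "\<dots> = (\<Prod>n<m. (1 - t) powr (1 / p n) * x n (I n))"
      using t by (simp add: prod.distrib powr_sum)
    also have "\<dots> \<le> (\<Prod>n<m. W n (I n))"
      using I x0 by (intro prod_mono) (auto intro!: W_old simp: idx_less)
    finally have "f I * ((1 - t) * (\<Prod>n<m. x n (I n))) \<le> f I * (\<Prod>n<m. W n (I n))"
      using fnn I by (intro mult_left_mono) auto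
    then show "(1 - t) * (f I * (\<Prod>n<m. x n (I n))) \<le> f I * (\<Prod>n<m. W n (I n))"
      by (simp add: algebra_simps)
  qed
  moreover have "mlf m d f W = f J * (\<Prod>n<m. W n (J n)) + (\<Sum>I\<in>idx m d - {J}. f I * (\<Prod>n<m. W n (I n)))"
    unfolding mlf_def using J by (intro sum.remove) auto
  moreover have "(\<Sum>I\<in>idx m d - {J}. (1 - t) * (f I * (\<Prod>n<m. x n (I n)))) = (1 - t) * mlf m d f x"
  proof -
    have "(\<Prod>n<m. x n (J n)) = 0" using um J(3) by (intro prod_zero) auto
    then have "mlf m d f x = (\<Sum>I\<in>idx m d - {J}. f I * (\<Prod>n<m. x n (I n)))"
      unfolding mlf_def using J by (subst sum.remove[of _ J]) simp_all
    then show ?thesis by (simp add: sum_distrib_left)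
  qed
  ultimately have "c * t powr s + (1 - t) * mlf m d f x \<le> mlf m d f W" by linarith
  also have "\<dots> \<le> mlf m d f x" by (rule max) fact
  finally show False using t(3) by (simp add: algebra_simps)
qed

section \<open>Critical points of the Rayleigh quotient\<close>

text \<open>The case a = 0 is included because nonnegative singular vectors may have zero
  coordinates. There the difference quotient is |h|^(q-1) in absolute value, and q > 1.\<close>

lemma has_derivative_abs_powr:
  fixes a q :: real
  assumes "q > 1" "a \<ge> 0"
  shows "((\<lambda>t. \<bar>t\<bar> powr q) has_real_derivative q * a powr (q - 1)) (at a)"
proof (cases "a = 0")
  case False
  then have a: "a > 0" using assms by simp
  show ?thesis
    by (rule has_field_derivative_transform_within_open[OF has_real_derivative_powr[OF a], of "{0<..}"])
       (use a in auto)
next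
  case True
  have "((\<lambda>h::real. \<bar>h\<bar> powr (q - 1)) \<longlongrightarrow> 0 powr (q - 1)) (at 0)"
    by (rule tendsto_powr2) (use assms in \<open>auto intro!: tendsto_eq_intros\<close>)
  then have "((\<lambda>h::real. \<bar>h\<bar> powr (q - 1)) \<longlongrightarrow> 0) (at 0)" by simp
  moreover have "norm ((\<bar>0 + h\<bar> powr q - \<bar>0\<bar> powr q) / h) \<le> \<bar>h\<bar> powr (q - 1)" for h :: real
    by (cases "h = 0") (simp_all add: powr_diff)
  ultimately have "((\<lambda>h::real. (\<bar>0 + h\<bar> powr q - \<bar>0\<bar> powr q) / h) \<longlongrightarrow> 0) (at 0)"
    by (rule Lim_null_comparison[OF always_eventually[OF allI], rotated])
  then show ?thesis using True assms by (simp add: DERIV_def)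
qed

text \<open>The positive factor, 1 / (S N P) in the proof, stays existential: only the vanishing of
  the bracket is of interest. Here S = N^(p k) with N the norm of block k, and P collects the other
  norms.\<close>

lemma Qf_upd_derivative:
  assumes k: "k < m" "j < d k" and p: "p k > 1" and x: "x k j \<ge> 0"
    and adm: "admissible m d x" and pos: "mlf m d f x > 0"
  shows "\<exists>c>0. ((\<lambda>t. Qf m d p f (upd x k j t)) has_real_derivative
      c * (pd m d f k j x * (\<Sum>j<d k. \<bar>x k j\<bar> powr p k) - mlf m d f x * x k j powr (p k - 1))) (at (x k j))"
proof -
  define a where "a = x k j"
  define S where "S = (\<Sum>j<d k. \<bar>x k j\<bar> powr p k)"
  define C where "C = (\<Sum>j'\<in>{..<d k}-{j}. \<bar>x k j'\<bar> powr p k)"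
  define P where "P = (\<Prod>l\<in>{..<m}-{k}. lpnorm (d l) (p l) (x l))"
  define F where "F = mlf m d f x"
  define D where "D = pd m d f k j x"
  define N where "N = S powr (1 / p k)"
  have lp: "lpnorm (d l) (p l) (x l) > 0" if "l < m" for l
    using adm that lpnorm_pos unfolding admissible_def by blast
  have P: "P > 0" unfolding P_def using lp by (intro prod_pos) auto
  have S: "S > 0" using adm k sum_abs_powr_pos unfolding admissible_def S_def by blast
  have Sa: "S = \<bar>a\<bar> powr p k + C"
    unfolding S_def C_def a_def using k by (intro sum.remove) auto
  have N: "N > 0" using S by (simp add: N_def)
  have lpu: "lpnorm (d k) (p k) ((x k)(j := t)) = (\<bar>t\<bar> powr p k + C) powr (1 / p k)" for t
  proof -
    have "(\<Sum>j'<d k. \<bar>((x k)(j := t)) j'\<bar> powr p k) = \<bar>t\<bar> powr p k + (\<Sum>j'\<in>{..<d k}-{j}. \<bar>((x k)(j := t)) j'\<bar> powr p k)"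
      using k by (subst sum.remove[of _ j]) auto
    also have "(\<Sum>j'\<in>{..<d k}-{j}. \<bar>((x k)(j := t)) j'\<bar> powr p k) = C"
      unfolding C_def by (intro sum.cong) auto
    finally show ?thesis by (simp add: lpnorm_def)
  qed
  have Q: "Qf m d p f (upd x k j t) = \<bar>F + (t - a) * D\<bar> / ((\<bar>t\<bar> powr p k + C) powr (1 / p k) * P)" for t
  proof -
    have "(\<Prod>l<m. lpnorm (d l) (p l) (upd x k j t l)) = lpnorm (d k) (p k) ((x k)(j := t)) * P"
      using k unfolding P_def upd_def by (subst prod.remove[of _ k]) (auto intro!: prod.cong)
    then show ?thesis using mlf_upd[of k m j d, OF k] by (simp add: Qf_def lpu F_def a_def D_def)
  qed
  have d1: "((\<lambda>t. \<bar>F + (t - a) * D\<bar>) has_real_derivative D) (at a)"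
  proof (rule has_field_derivative_transform_within_open[of "\<lambda>t. F + (t - a) * D" _ _ "{t. F + (t - a) * D > 0}"])
    show "open {t. F + (t - a) * D > 0}" by (intro open_Collect_less continuous_intros)
    show "a \<in> {t. F + (t - a) * D > 0}" using pos by (simp add: F_def)
  qed (auto intro!: derivative_eq_intros)
  have "((\<lambda>t. \<bar>t\<bar> powr p k + C) has_real_derivative p k * a powr (p k - 1)) (at a)"
    using DERIV_add[OF has_derivative_abs_powr[OF p, of a] DERIV_const[of C]] x by (simp add: a_def)
  from DERIV_fun_powr[OF this, of "1 / p k"]
  have d2: "((\<lambda>t. (\<bar>t\<bar> powr p k + C) powr (1 / p k)) has_real_derivative N / S * a powr (p k - 1)) (at a)"
    using S p by (simp add: Sa[symmetric] N_def powr_diff)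
  have "((\<lambda>t. \<bar>F + (t - a) * D\<bar> / ((\<bar>t\<bar> powr p k + C) powr (1 / p k) * P)) has_real_derivative
      (D * (N * P) - F * (N / S * a powr (p k - 1) * P)) / ((N * P) * (N * P))) (at a)"
    using DERIV_divide[OF d1 DERIV_cmult_right[OF d2, of P]] P N pos
    by (simp add: Sa[symmetric] N_def[symmetric] F_def)
  also have "(D * (N * P) - F * (N / S * a powr (p k - 1) * P)) / ((N * P) * (N * P))
      = 1 / (S * N * P) * (D * S - F * a powr (p k - 1))"
    using S N P by (simp add: field_simps)
  finally show ?thesis
    unfolding Q using S N P by (intro exI[of _ "1 / (S * N * P)"]) (auto simp: D_def S_def F_def a_def)
qed

text \<open>The sum on the left is the p_k-th power of the norm of x_k, so the equation also applies
  to singular vectors that are not normalized.\<close>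

lemma Qf_upd_stationary_iff:
  assumes "k < m" "j < d k" "p k > 1" "x k j \<ge> 0" "admissible m d x" "mlf m d f x > 0"
  shows "((\<lambda>t. Qf m d p f (upd x k j t)) has_real_derivative 0) (at (x k j))
    \<longleftrightarrow> pd m d f k j x * (\<Sum>j<d k. \<bar>x k j\<bar> powr p k) = mlf m d f x * x k j powr (p k - 1)"
proof -
  from Qf_upd_derivative[of k m j d p x f, OF assms] obtain c where "c > 0" and D:
    "((\<lambda>t. Qf m d p f (upd x k j t)) has_real_derivative
      c * (pd m d f k j x * (\<Sum>j<d k. \<bar>x k j\<bar> powr p k) - mlf m d f x * x k j powr (p k - 1))) (at (x k j))"
    by blast
  show ?thesis
  proof
    assume "((\<lambda>t. Qf m d p f (upd x k j t)) has_real_derivative 0) (at (x k j))"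
    from DERIV_unique[OF this D] \<open>c > 0\<close>
    show "pd m d f k j x * (\<Sum>j<d k. \<bar>x k j\<bar> powr p k) = mlf m d f x * x k j powr (p k - 1)" by simp
  qed (use D in simp)
qed

section \<open>Uniqueness\<close>

lemma pd_cong:
  assumes "\<And>k j. k < m \<Longrightarrow> j < d k \<Longrightarrow> x k j = y k j"
  shows "pd m d f k j x = pd m d f k j y"
  unfolding pd_def by (rule mlf_cong) (simp add: assms)

lemma mlf_scale_all: "mlf m d f (\<lambda>k j. c k * x k j) = (\<Prod>k<m. c k) * mlf m d f x"
  by (simp add: mlf_def prod.distrib sum_distrib_left algebra_simps)

text \<open>The derivative scales with all factors except c k; multiplying by c k avoids a
  division.\<close>

lemma pd_scale_all:
  assumes "k < m"
  shows "c k * pd m d f k j (\<lambda>k j. c k * x k j) = (\<Prod>k<m. c k) * pd m d f k j x"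
proof -
  have "(\<lambda>k j. c k * x k j)(k := \<lambda>_. 1) = (\<lambda>l j. (c(k := 1)) l * (x(k := \<lambda>_. 1)) l j)"
    by (auto simp: fun_eq_iff)
  then have "pd m d f k j (\<lambda>k j. c k * x k j) = (\<Prod>l<m. (c(k := 1)) l) * pd m d f k j x"
    unfolding pd_def by (simp only: mlf_scale_all)
  moreover have "(\<Prod>l<m. (c(k := 1)) l) = (\<Prod>l\<in>{..<m}-{k}. c l)"
    using assms by (subst prod.remove[of _ k]) (auto intro!: prod.cong)
  moreover have "(\<Prod>l<m. c l) = c k * (\<Prod>l\<in>{..<m}-{k}. c l)"
    using assms by (intro prod.remove) auto
  ultimately show ?thesis by (simp add: mult.assoc)
qed

text \<open>The part of the theory that rests on the sum condition; the distinguished mode i joins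
  in \<open>perron_frobenius_tensor_mode\<close>.\<close>

locale perron_frobenius_tensor =
  fixes m :: nat and d :: "nat \<Rightarrow> nat" and p :: "nat \<Rightarrow> real" and f :: "(nat \<Rightarrow> nat) \<Rightarrow> real"
  assumes m2: "m \<ge> 2" and d1: "\<And>k. k < m \<Longrightarrow> d k \<ge> 1" and wi: "weakly_irreducible m d f"
    and p1: "\<And>k. k < m \<Longrightarrow> 1 < p k" and sum_p: "(\<Sum>k<m. 1 / p k) \<le> 1"
begin

lemma p_pos: "k < m \<Longrightarrow> 0 < p k"
  using p1[of k] by simp

lemma nonneg: "nonneg_tensor m d f"
  using wi by (rule weakly_irreducible_nonneg)

definition positive :: "(nat \<Rightarrow> nat \<Rightarrow> real) \<Rightarrow> bool" where
  "positive x \<longleftrightarrow> (\<forall>k<m. \<forall>j<d k. 0 < x k j)"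

lemma positiveD: "positive x \<Longrightarrow> k < m \<Longrightarrow> j < d k \<Longrightarrow> 0 < x k j"
  by (simp add: positive_def)

lemma positive_admissible: "positive x \<Longrightarrow> admissible m d x"
  unfolding positive_def admissible_def using d1 by (metis less_irrefl less_le_trans zero_less_one)

lemma Spp_positive: "x \<in> Spp m d p \<Longrightarrow> positive x"
  by (simp add: Spp_def positive_def)

lemma Spp_lpnorm: "x \<in> Spp m d p \<Longrightarrow> k < m \<Longrightarrow> lpnorm (d k) (p k) (x k) = 1"
  by (simp add: Spp_def)

lemma Spp_sum_powr:
  assumes "x \<in> Spp m d p" "k < m"
  shows "(\<Sum>j<d k. x k j powr p k) = 1"
proof -
  have "(\<Sum>j<d k. x k j powr p k) = (\<Sum>j<d k. \<bar>x k j\<bar> powr p k)"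
    using positiveD[OF Spp_positive[OF assms(1)] assms(2)] by (intro sum.cong) (auto simp: abs_of_pos)
  then show ?thesis using Spp_lpnorm[OF assms] p_pos[OF assms(2)] by (simp add: lpnorm_eq_1_iff)
qed

text \<open>With at least two modes there is a vertex in another mode, so the path leading to it has
  a first edge, and an edge comes from a positive entry.\<close>

lemma ex_support:
  assumes "k < m" "j < d k"
  shows "\<exists>J\<in>idx m d. J k = j \<and> f J > 0"
proof -
  define k' where "k' = (if k = 0 then 1 else 0 :: nat)"
  have k': "k' < m" "k' \<noteq> k" using m2 by (auto simp: k'_def)
  then have "(gadj m d f)\<^sup>*\<^sup>* (k, j) (k', 0)"
    using wi assms d1[of k'] by (auto simp: weakly_irreducible_def vertices_def)
  then obtain v where "gadj m d f (k, j) v"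
    by (rule converse_rtranclpE) (use k' in auto)
  then show ?thesis by (auto simp: gadj_def)
qed

lemma positive_pd_pos:
  assumes "positive x" "k < m" "j < d k"
  shows "pd m d f k j x > 0"
proof -
  obtain J where "J \<in> idx m d" "J k = j" "f J > 0" using ex_support[OF assms(2,3)] by auto
  then show ?thesis using assms(1) nonneg
    by (intro pd_pos[of m d f J]) (auto simp: positive_def idx_less less_imp_le)
qed

lemma positive_mlf_pos:
  assumes "positive x"
  shows "mlf m d f x > 0"
proof -
  have "0 < m" using m2 by simp
  moreover from this have "0 < d 0" using d1[of 0] by simp
  ultimately obtain J where "J \<in> idx m d" "f J > 0" using ex_support[of 0 0] by auto
  then show ?thesis using assms nonneg
    by (intro mlf_pos[of m d f J]) (auto simp: positive_def idx_less less_imp_le)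
qed

section \<open>Attainment of the norm, and the equations at a maximizer\<close>

lemma Qf_Spp:
  assumes "x \<in> Spp m d p"
  shows "Qf m d p f x = mlf m d f x"
  using positive_mlf_pos[OF Spp_positive[OF assms]] Spp_lpnorm[OF assms] by (simp add: Qf_def)

lemma ex_maximizer: "\<exists>x\<in>Spp m d p. \<forall>y. admissible m d y \<longrightarrow> Qf m d p f y \<le> Qf m d p f x"
proof -
  obtain x where x: "x \<in> Snn m d p" and max: "\<And>y. y \<in> Snn m d p \<Longrightarrow> mlf m d f y \<le> mlf m d f x"
    using mlf_attains_max_Snn[of m p d f] p_pos d1 by blast
  have "0 < x k j" if "k < m" "j < d k" for k j
    using p_pos d1 sum_p wi x max that by (rule maximizer_pos)
  then have xS: "x \<in> Spp m d p" using x by (simp add: Spp_def Snn_def)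
  moreover have "Qf m d p f y \<le> Qf m d p f x" if "admissible m d y" for y
    using Qf_le_mlf_normalized[of m p d f y] p_pos nonneg that max Qf_Spp[OF xS] by fastforce
  ultimately show ?thesis by blast
qed

lemma ex_Qf_eq_tnorm: "\<exists>x\<in>Spp m d p. Qf m d p f x = tnorm m d p f"
  and Qf_le_tnorm: "admissible m d y \<Longrightarrow> Qf m d p f y \<le> tnorm m d p f"
proof -
  obtain x where x: "x \<in> Spp m d p" "\<And>y. admissible m d y \<Longrightarrow> Qf m d p f y \<le> Qf m d p f x"
    using ex_maximizer by blast
  have "tnorm m d p f = Qf m d p f x"
    unfolding tnorm_def
    by (rule cSup_eq_maximum) (use x positive_admissible[OF Spp_positive[OF x(1)]] in auto)
  with x show "\<exists>x\<in>Spp m d p. Qf m d p f x = tnorm m d p f"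
    and "admissible m d y \<Longrightarrow> Qf m d p f y \<le> tnorm m d p f" by auto
qed

lemma maximizer_stationary:
  assumes x: "x \<in> Spp m d p" "Qf m d p f x = tnorm m d p f" and k: "k < m" "j < d k"
  shows "((\<lambda>t. Qf m d p f (upd x k j t)) has_real_derivative 0) (at (x k j))"
proof -
  have pos: "0 < x k j" using positiveD[OF Spp_positive[OF x(1)]] k by simp
  obtain D where D: "((\<lambda>t. Qf m d p f (upd x k j t)) has_real_derivative D) (at (x k j))"
    using Qf_upd_derivative[of k m j d p x f] k p1[OF k(1)] pos positive_admissible positive_mlf_pos
      Spp_positive[OF x(1)] by auto
  have "D = 0"
  proof (rule DERIV_local_max[OF D pos], intro allI impI)
    \<comment> \<open>The radius x k j keeps the moved coordinate positive, so every competitor is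
      admissible.\<close>
    fix t assume "\<bar>x k j - t\<bar> < x k j"
    then have "positive (upd x k j t)"
      using Spp_positive[OF x(1)] by (auto simp: positive_def upd_def)
    then have "Qf m d p f (upd x k j t) \<le> tnorm m d p f" by (intro Qf_le_tnorm positive_admissible)
    also have "\<dots> = Qf m d p f (upd x k j (x k j))" using x(2) by (simp add: upd_def)
    finally show "Qf m d p f (upd x k j t) \<le> Qf m d p f (upd x k j (x k j))" .
  qed
  with D show ?thesis by simp
qed

lemma maximizer_pd_eq:
  assumes x: "x \<in> Spp m d p" "Qf m d p f x = tnorm m d p f" and k: "k < m" "j < d k"
  shows "pd m d f k j x = mlf m d f x * x k j powr (p k - 1)"
proof -
  have "pd m d f k j x * (\<Sum>j<d k. \<bar>x k j\<bar> powr p k) = mlf m d f x * x k j powr (p k - 1)"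
    using Qf_upd_stationary_iff[of k m j d p x f] maximizer_stationary[OF x, of k j] k p1[OF k(1)]
      positive_admissible positive_mlf_pos Spp_positive[OF x(1)]
      positiveD[OF Spp_positive[OF x(1)], of k j] by auto
  moreover have "(\<Sum>j<d k. \<bar>x k j\<bar> powr p k) = 1"
    using Spp_lpnorm[OF x(1) k(1)] p_pos[OF k(1)] by (simp add: lpnorm_eq_1_iff)
  ultimately show ?thesis by simp
qed

text \<open>Only z is stationary; w merely has to do at least as well. The lemma therefore serves
  both for two maximizers and for a singular vector against a maximizer. The ratios agree along
  edges, hence within each block by connectedness, and since both blocks are normalized the common
  ratio is 1.\<close>

lemma stationary_unique:
  assumes z: "z \<in> Spp m d p" and w: "w \<in> Spp m d p"
    and pd: "\<And>k j. k < m \<Longrightarrow> j < d k \<Longrightarrow> pd m d f k j z = mlf m d f z * z k j powr (p k - 1)"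
    and le: "mlf m d f z \<le> mlf m d f w"
  shows "z = w"
proof -
  interpret tensor_amgm m d p f z w
    using nonneg p_pos sum_p positiveD[OF Spp_positive[OF z]] positiveD[OF Spp_positive[OF w]]
    by unfold_locales auto
  have eigen: "z k j * pd m d f k j z \<le> mlf m d f z * z k j powr p k" if "k < m" "j < d k" for k j
    using pd[OF that] z_pos[OF that] by (simp add: powr_diff)
  have adj: "ratio (fst u) (snd u) = ratio (fst v) (snd v)" if "gadj m d f u v" for u v
  proof -
    from that obtain J where "J \<in> idx m d" "f J > 0" "J (fst u) = snd u" "J (fst v) = snd v"
      "fst u < m" "fst v < m" by (auto simp: gadj_def vertices_def)
    with ratio_eq_on_support[OF eigen Spp_lpnorm[OF w] le] show ?thesis by metis
  qed
  have path: "ratio (fst u) (snd u) = ratio (fst v) (snd v)" if "(gadj m d f)\<^sup>*\<^sup>* u v" for u v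
    using that by (induction rule: rtranclp_induct) (auto dest: adj)
  have same: "ratio k j = ratio k j'" if "k < m" "j < d k" "j' < d k" for k j j'
    using path[of "(k, j)" "(k, j')"] wi that by (auto simp: weakly_irreducible_def vertices_def)
  have "z k j = w k j" for k j
  proof (cases "k < m \<and> j < d k")
    case True
    then have k: "k < m" "j < d k" by auto
    have wz: "w k j' powr p k = ratio k j * z k j' powr p k" if "j' < d k" for j'
      using same[OF k that] z_pos[OF k(1) that] w_pos[OF k(1) that] by (simp add: ratio_def powr_divide)
    have "1 = (\<Sum>j'<d k. w k j' powr p k)" using Spp_sum_powr[OF w k(1)] by simp
    also have "\<dots> = ratio k j" using wz Spp_sum_powr[OF z k(1)] by (simp add: sum_distrib_left[symmetric])
    finally have "w k j powr p k = z k j powr p k" using wz[OF k(2)] by simp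
    then show ?thesis
      using z_pos[OF k] w_pos[OF k] p_pos[OF k(1)] by (metis less_imp_le powr_inj less_irrefl powr_powr powr_one right_inverse)
  next
    case False
    then show ?thesis using z w by (simp add: Spp_def)
  qed
  then show ?thesis by (simp add: fun_eq_iff)
qed

text \<open>Irreducibility applied to the zero set Z yields a positive entry with exactly one index
  in Z. The partial derivative at that coordinate is then positive, whereas stationarity at a zero
  coordinate forces it to vanish.\<close>

lemma nonneg_singular_vector_positive:
  assumes irr: "irreducible_tensor m d f" and y: "singular_vector m d p f y"
    and y0: "\<And>k j. k < m \<Longrightarrow> j < d k \<Longrightarrow> 0 \<le> y k j" and pos: "0 < mlf m d f y"
  shows "positive y"
proof (rule ccontr)
  define Z where "Z = {(k, j). k < m \<and> j < d k \<and> y k j = 0}"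
  assume "\<not> positive y"
  then have "Z \<noteq> {}" using y0 unfolding positive_def Z_def by (fastforce simp: less_le)
  moreover have "Z \<subseteq> vertices m d" by (auto simp: Z_def vertices_def)
  moreover have "Z \<noteq> vertices m d"
  proof -
    have adm: "admissible m d y" and "0 < m" using y m2 by (auto simp: singular_vector_def)
    then obtain j where "j < d 0" "y 0 j \<noteq> 0" by (auto simp: admissible_def)
    then have "(0, j) \<in> vertices m d" "(0, j) \<notin> Z" using \<open>0 < m\<close> by (auto simp: Z_def vertices_def)
    then show ?thesis by blast
  qed
  ultimately obtain k j J where kj: "(k, j) \<in> Z" and J: "J \<in> idx m d" "J k = j" "f J > 0"
    and out: "\<And>l. l < m \<Longrightarrow> l \<noteq> k \<Longrightarrow> (l, J l) \<in> vertices m d - Z"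
    using irr unfolding irreducible_tensor_def by blast
  have k: "k < m" "j < d k" "y k j = 0" using kj by (auto simp: Z_def)
  have "0 < pd m d f k j y"
  proof (rule pd_pos[OF nonneg J(1,3,2)])
    show "0 < y l (J l)" if "l < m" "l \<noteq> k" for l
      using out[OF that] y0[of l "J l"] that by (auto simp: Z_def vertices_def less_le)
  qed (use y0 in auto)
  moreover have "pd m d f k j y * (\<Sum>j<d k. \<bar>y k j\<bar> powr p k) = mlf m d f y * y k j powr (p k - 1)"
    using Qf_upd_stationary_iff[of k m j d p y f] y k(1,2) y0[OF k(1,2)] p1[OF k(1)] pos
    by (simp add: singular_vector_def)
  moreover have "0 < (\<Sum>j<d k. \<bar>y k j\<bar> powr p k)"
    using y k sum_abs_powr_pos unfolding singular_vector_def admissible_def by blast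
  ultimately show False using k(3) by simp
qed

text \<open>Dividing each block of y by its norm gives a stationary point of \<open>Spp\<close>, to
  be compared with the maximizer x. The block norms are the scale factors.\<close>

lemma nonneg_singular_vector_unique:
  assumes irr: "irreducible_tensor m d f" and y: "singular_vector m d p f y"
    and y0: "\<And>k j. k < m \<Longrightarrow> j < d k \<Longrightarrow> 0 \<le> y k j"
    and x: "x \<in> Spp m d p" "Qf m d p f x = tnorm m d p f"
  shows "\<exists>c. (\<forall>k<m. c k > 0) \<and> (\<forall>k<m. \<forall>j<d k. y k j = c k * x k j)"
proof -
  have "mlf m d f y \<ge> 0"
    unfolding mlf_def using nonneg y0
    by (intro sum_nonneg mult_nonneg_nonneg prod_nonneg) (auto simp: nonneg_tensor_def idx_less)
  then have pos: "mlf m d f y > 0" using y by (auto simp: singular_vector_def)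
  have yp: "positive y" using irr y y0 pos by (rule nonneg_singular_vector_positive)
  define N where "N k = lpnorm (d k) (p k) (y k)" for k
  have N: "N k > 0" if "k < m" for k
    using lpnorm_pos positive_admissible[OF yp] that unfolding N_def admissible_def by blast
  define z where "z k j = (if k < m \<and> j < d k then 1 / N k * y k j else 0)" for k j
  have z_eq: "z k j = 1 / N k * y k j" if "k < m" "j < d k" for k j using that by (simp add: z_def)
  have mlf_z: "mlf m d f z = (\<Prod>k<m. 1 / N k) * mlf m d f y"
    by (subst mlf_scale_all[symmetric], rule mlf_cong) (simp add: z_eq)
  have zS: "z \<in> Spp m d p"
  proof -
    have "lpnorm (d k) (p k) (z k) = 1" if k: "k < m" for k
    proof -
      have "lpnorm (d k) (p k) (z k) = lpnorm (d k) (p k) (\<lambda>j. y k j / N k)"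
        using k by (intro lpnorm_cong) (simp add: z_def)
      also have "\<dots> = 1"
        unfolding N_def using positive_admissible[OF yp] k p_pos[OF k] lpnorm_normalized
        unfolding admissible_def by blast
      finally show ?thesis .
    qed
    then show ?thesis using N yp by (auto simp: Spp_def z_def positive_def)
  qed
  have "z = x"
  proof (rule stationary_unique[OF zS x(1)])
    show "mlf m d f z \<le> mlf m d f x"
      using Qf_le_tnorm[OF positive_admissible[OF Spp_positive[OF zS]]] x Qf_Spp zS by simp
    fix k j assume k: "k < m" "j < d k"
    have ykj: "0 < y k j" using yp k by (simp add: positive_def)
    have "pd m d f k j y * (\<Sum>j<d k. \<bar>y k j\<bar> powr p k) = mlf m d f y * y k j powr (p k - 1)"
      using Qf_upd_stationary_iff[of k m j d p y f] y k p1 pos ykj by (auto simp: singular_vector_def)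
    then have st: "pd m d f k j y * N k powr p k = mlf m d f y * y k j powr (p k - 1)"
      using lpnorm_powr[OF p_pos[OF k(1)]] by (simp add: N_def)
    have "1 / N k * pd m d f k j z = 1 / N k * pd m d f k j (\<lambda>k j. 1 / N k * y k j)"
      by (intro arg_cong2[where f="(*)"] refl pd_cong) (simp add: z_eq)
    also have "\<dots> = (\<Prod>k<m. 1 / N k) * pd m d f k j y"
      by (rule pd_scale_all[OF k(1)])
    also have "pd m d f k j y = mlf m d f y * (y k j powr (p k - 1) / N k powr p k)"
      using st N[OF k(1)] by (simp add: field_simps)
    also have "y k j powr (p k - 1) / N k powr p k = 1 / N k * z k j powr (p k - 1)"
      using k N[OF k(1)] ykj by (simp add: z_def powr_divide powr_diff field_simps)
    finally have "1 / N k * pd m d f k j z = 1 / N k * (mlf m d f z * z k j powr (p k - 1))"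
      by (simp add: mlf_z mult.assoc)
    then show "pd m d f k j z = mlf m d f z * z k j powr (p k - 1)"
      using N[OF k(1)] by simp
  qed
  then have "y k j = N k * x k j" if "k < m" "j < d k" for k j
    using z_eq[OF that] N[OF that(1)] by simp
  then show ?thesis using N by (intro exI[of _ N]) auto
qed

end

section \<open>Collatz-Wielandt quotients\<close>

lemma conj_exp_facts:
  assumes "1 < q"
  shows "conj_exp q > 1" "conj_exp q - 1 = 1 / (q - 1)" "(conj_exp q - 1) * q = conj_exp q"
    "conj_exp q * (1 - 1 / q) = 1" "1 / q + 1 / conj_exp q = 1"
  using assms by (auto simp: conj_exp_def field_simps)

locale perron_frobenius_tensor_mode = perron_frobenius_tensor +
  fixes i :: nat
  assumes i: "i < m" and p_ge: "\<And>k. k < m \<Longrightarrow> k \<noteq> i \<Longrightarrow> real (m - 1) * conj_exp (p i) \<le> p k"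
begin

abbreviation "q \<equiv> conj_exp (p i)"

text \<open>The Hoelder dual of the mode-i gradient: up to scale it maximizes f over x_i while the
  other blocks are fixed. The sign in \<open>psi\<close> can be left out, as the gradient is
  positive at positive points.\<close>

definition dual :: "(nat \<Rightarrow> nat \<Rightarrow> real) \<Rightarrow> nat \<Rightarrow> real" where
  "dual x j = pd m d f i j x powr (q - 1)"

definition lift :: "(nat \<Rightarrow> nat \<Rightarrow> real) \<Rightarrow> nat \<Rightarrow> nat \<Rightarrow> real" where
  "lift x = x(i := dual x)"

definition quot :: "(nat \<Rightarrow> nat \<Rightarrow> real) \<Rightarrow> nat \<Rightarrow> nat \<Rightarrow> real" where
  "quot x k j = (sfun m d p f i k j x / x k j) powr (p k - 1)"

lemma q_facts: "q > 1" "q - 1 = 1 / (p i - 1)" "(q - 1) * p i = q" "q * (1 - 1 / p i) = 1" "1 / p i + 1 / q = 1"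
  using conj_exp_facts[OF p1[OF i]] by auto

lemma lift_positive:
  assumes "positive x"
  shows "positive (lift x)"
  using assms positive_pd_pos[OF assms i] by (auto simp: positive_def lift_def dual_def less_imp_neq[symmetric])

text \<open>The outer \<open>psi\<close> of \<open>sfun\<close> raises to the power 1 / (p k - 1),
  which the exponent p k - 1 undoes. What remains is the quotient of the two sides of the critical
  point equation at the lifted point.\<close>

lemma quot_eq:
  assumes x: "positive x" and k: "k < m" "k \<noteq> i" "j < d k"
  shows "quot x k j = pd m d f k j (lift x) / x k j powr (p k - 1)"
proof -
  have "(\<Sum>ji<d i. psi q (tpartial i ji (mlf m d f) x) * tpartial i ji (tpartial k j (mlf m d f)) x)
      = (\<Sum>ji<d i. dual x ji * tpartial i ji (tpartial k j (mlf m d f)) x)"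
    using positive_pd_pos[OF x i] i by (intro sum.cong) (simp_all add: tpartial_mlf psi_def dual_def abs_of_pos)
  also have "\<dots> = pd m d f k j (lift x)"
    using k i by (simp add: sum_tpartial_tpartial_mlf lift_def)
  finally have "sfun m d p f i k j x = psi (conj_exp (p k)) (pd m d f k j (lift x))"
    by (simp add: sfun_def)
  moreover have P: "0 < pd m d f k j (lift x)" by (rule positive_pd_pos[OF lift_positive[OF x] k(1,3)])
  ultimately have "sfun m d p f i k j x = pd m d f k j (lift x) powr (1 / (p k - 1))"
    using conj_exp_facts(2)[OF p1[OF k(1)]] by (simp add: psi_def)
  then show ?thesis
    using P positiveD[OF x k(1,3)] p1[OF k(1)] by (simp add: quot_def powr_divide powr_powr)
qed

lemma mlf_lift:
  assumes "positive x"
  shows "mlf m d f (lift x) = (\<Sum>j<d i. dual x j powr p i)"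
  unfolding lift_def mlf_fun_upd[OF i]
proof (rule sum.cong[OF refl])
  fix j assume "j \<in> {..<d i}"
  then have P: "0 < pd m d f i j x" using positive_pd_pos[OF assms i] by simp
  have "dual x j powr p i = pd m d f i j x powr q"
    by (simp add: dual_def powr_powr q_facts(3))
  then show "dual x j * pd m d f i j x = dual x j powr p i"
    using P by (simp add: dual_def powr_diff)
qed

text \<open>The mode-i equation holds exactly at the lifted point, with multiplier 1; hence the
  choice of the i-th multiplier in \<open>tnorm_le_prod_Max_quot\<close>.\<close>

lemma lift_dual_eq:
  assumes "positive x" "j < d i"
  shows "lift x i j * pd m d f i j (lift x) = lift x i j powr p i"
proof -
  have P: "0 < pd m d f i j x" using positive_pd_pos[OF assms(1) i assms(2)] .
  have "dual x j powr p i = pd m d f i j x powr q"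
    by (simp add: dual_def powr_powr q_facts(3))
  then show ?thesis using P by (simp add: lift_def dual_def powr_diff)
qed

lemma mlf_lift_pos: "positive x \<Longrightarrow> 0 < mlf m d f (lift x)"
  by (intro positive_mlf_pos lift_positive)

text \<open>Euler's identity in mode k at the lifted point, whose block k is still x_k.\<close>

lemma sum_quot:
  assumes x: "x \<in> Spp m d p" and k: "k < m" "k \<noteq> i"
  shows "(\<Sum>j<d k. x k j powr p k * quot x k j) = mlf m d f (lift x)"
proof -
  note xp = Spp_positive[OF x]
  have "(\<Sum>j<d k. x k j powr p k * quot x k j) = (\<Sum>j<d k. lift x k j * pd m d f k j (lift x))"
  proof (intro sum.cong refl)
    fix j assume "j \<in> {..<d k}"
    then have j: "j < d k" by simp
    show "x k j powr p k * quot x k j = lift x k j * pd m d f k j (lift x)"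
      unfolding quot_eq[OF xp k j] using positiveD[OF xp k(1) j] k
      by (simp add: lift_def powr_diff)
  qed
  then show ?thesis by (simp add: mlf_expand[OF k(1)])
qed

lemma Min_quot_le:
  assumes x: "x \<in> Spp m d p" and k: "k < m" "k \<noteq> i"
  shows "Min (quot x k ` {..<d k}) \<le> mlf m d f (lift x)"
proof -
  have "Min (quot x k ` {..<d k}) = (\<Sum>j<d k. x k j powr p k * Min (quot x k ` {..<d k}))"
    using Spp_sum_powr[OF x k(1)] by (simp add: sum_distrib_right[symmetric])
  also have "\<dots> \<le> (\<Sum>j<d k. x k j powr p k * quot x k j)"
    by (intro sum_mono mult_left_mono) auto
  finally show ?thesis using sum_quot[OF x k] by simp
qed

lemma Max_quot_ge:
  assumes x: "x \<in> Spp m d p" and k: "k < m" "k \<noteq> i"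
  shows "mlf m d f (lift x) \<le> Max (quot x k ` {..<d k})"
proof -
  have "(\<Sum>j<d k. x k j powr p k * quot x k j) \<le> (\<Sum>j<d k. x k j powr p k * Max (quot x k ` {..<d k}))"
    by (intro sum_mono mult_left_mono) auto
  also have "\<dots> = Max (quot x k ` {..<d k})"
    using Spp_sum_powr[OF x k(1)] by (simp add: sum_distrib_right[symmetric])
  finally show ?thesis using sum_quot[OF x k] by simp
qed

lemma mlf_lift_le_tnorm:
  assumes x: "x \<in> Spp m d p"
  shows "mlf m d f (lift x) \<le> tnorm m d p f powr q"
proof -
  note xp = Spp_positive[OF x]
  define F where "F = mlf m d f (lift x)"
  have F: "F > 0" unfolding F_def by (rule mlf_lift_pos[OF xp])
  have "(\<Sum>j<d i. \<bar>dual x j\<bar> powr p i) = F"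
    unfolding F_def mlf_lift[OF xp] by (simp add: dual_def)
  then have "lpnorm (d i) (p i) (dual x) = F powr (1 / p i)" by (simp add: lpnorm_def)
  moreover have "(\<Prod>k<m. lpnorm (d k) (p k) (lift x k)) = lpnorm (d i) (p i) (dual x)"
    using i Spp_lpnorm[OF x] by (subst prod.remove[of _ i]) (auto simp: lift_def)
  ultimately have "Qf m d p f (lift x) = F powr (1 - 1 / p i)"
    using F by (simp add: Qf_def F_def[symmetric] powr_diff)
  moreover have "Qf m d p f (lift x) \<le> tnorm m d p f"
    by (intro Qf_le_tnorm positive_admissible lift_positive xp)
  ultimately have "(F powr (1 - 1 / p i)) powr q \<le> tnorm m d p f powr q"
    using q_facts(1) by (intro powr_mono2) auto
  then show ?thesis using F q_facts(4) by (simp add: powr_powr mult.commute F_def)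
qed

section \<open>The two bounds of the minimax identity, and their attainment\<close>

lemma card_other_modes: "card ({..<m} - {i}) = m - 1"
  using i by simp

lemma powr_modes: "(c powr q) ^ (m - 1) = (c::real) powr (q * real (m - 1))"
  using m2 powr_power[of c q "m - 1"] by (cases "c = 0") (simp_all add: mult.commute)

lemma prod_Min_quot_le:
  assumes x: "x \<in> Spp m d p"
  shows "(\<Prod>k\<in>{..<m}-{i}. Min (quot x k ` {..<d k})) \<le> tnorm m d p f powr (q * real (m - 1))"
proof -
  have "(\<Prod>k\<in>{..<m}-{i}. Min (quot x k ` {..<d k})) \<le> (\<Prod>k\<in>{..<m}-{i}. tnorm m d p f powr q)"
  proof (intro prod_mono conjI)
    fix k assume "k \<in> {..<m} - {i}"
    then have k: "k < m" "k \<noteq> i" by auto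
    show "Min (quot x k ` {..<d k}) \<le> tnorm m d p f powr q"
      using Min_quot_le[OF x k] mlf_lift_le_tnorm[OF x] by simp
    have "{..<d k} \<noteq> {}" using d1[OF k(1)] by (auto simp: lessThan_empty_iff)
    then show "0 \<le> Min (quot x k ` {..<d k})" by (subst Min_ge_iff) (auto simp: quot_def)
  qed
  then show ?thesis by (simp only: prod_constant card_other_modes powr_modes)
qed

lemma tnorm_le_prod_Max_quot:
  assumes x: "x \<in> Spp m d p"
  shows "tnorm m d p f powr (q * real (m - 1)) \<le> (\<Prod>k\<in>{..<m}-{i}. Max (quot x k ` {..<d k}))"
proof -
  note xp = Spp_positive[OF x]
  obtain w where w: "w \<in> Spp m d p" "Qf m d p f w = tnorm m d p f" using ex_Qf_eq_tnorm by blast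
  interpret tensor_amgm m d p f "lift x" w
    using nonneg p_pos sum_p positiveD[OF lift_positive[OF xp]] positiveD[OF Spp_positive[OF w(1)]]
    by unfold_locales auto
  define M where "M = real (m - 1)"
  have M: "M \<ge> 1" using m2 by (simp add: M_def)
  define F where "F = mlf m d f (lift x)"
  have F: "F > 0" unfolding F_def by (rule mlf_lift_pos[OF xp])
  define \<Lambda> where "\<Lambda> k = Max (quot x k ` {..<d k})" for k
  have \<Lambda>: "F \<le> \<Lambda> k" if "k < m" "k \<noteq> i" for k unfolding F_def \<Lambda>_def by (rule Max_quot_ge[OF x that])
  \<comment> \<open>The largest quotient is the best multiplier in each mode other than i; mode i
    has multiplier 1 by \<open>lift_dual_eq\<close>.\<close>
  define \<mu> where "\<mu> = \<Lambda>(i := 1)"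
  have "mlf m d f w \<le> F * (\<Prod>k<m. (\<mu> k / F) powr (1 / p k))"
    unfolding F_def
  proof (rule mlf_le_of_subeigen)
    show "0 < mlf m d f (lift x)" using F by (simp add: F_def)
    show "0 < \<mu> k" if "k < m" for k using \<Lambda>[OF that] F by (auto simp: \<mu>_def)
    show "lpnorm (d k) (p k) (w k) = 1" if "k < m" for k using Spp_lpnorm[OF w(1) that] .
    show "lift x k j * pd m d f k j (lift x) \<le> \<mu> k * lift x k j powr p k" if k: "k < m" "j < d k" for k j
    proof (cases "k = i")
      case True
      then show ?thesis using lift_dual_eq[OF xp] k by (simp add: \<mu>_def)
    next
      case False
      have X: "0 < x k j" using positiveD[OF xp k] .
      have "quot x k j \<le> \<Lambda> k" using k by (simp add: \<Lambda>_def)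
      then have "pd m d f k j (lift x) \<le> \<Lambda> k * x k j powr (p k - 1)"
        unfolding quot_eq[OF xp k(1) False k(2)] using X by (simp add: pos_divide_le_eq)
      then have "x k j * pd m d f k j (lift x) \<le> x k j * (\<Lambda> k * x k j powr (p k - 1))"
        using X by (intro mult_left_mono) auto
      then show ?thesis using False X by (simp add: \<mu>_def lift_def powr_diff)
    qed
  qed
  also have "(\<Prod>k<m. (\<mu> k / F) powr (1 / p k))
      = (1 / F) powr (1 / p i) * (\<Prod>k\<in>{..<m}-{i}. (\<Lambda> k / F) powr (1 / p k))"
    using i by (subst prod.remove[of _ i]) (auto simp: \<mu>_def intro!: prod.cong)
  also have "F * ((1 / F) powr (1 / p i) * (\<Prod>k\<in>{..<m}-{i}. (\<Lambda> k / F) powr (1 / p k)))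
      = F powr (1 / q) * (\<Prod>k\<in>{..<m}-{i}. (\<Lambda> k / F) powr (1 / p k))"
  proof -
    have "1 / q = 1 - 1 / p i" using q_facts(5) by simp
    then have "F powr (1 / q) = F * (1 / F) powr (1 / p i)"
      using F by (simp add: powr_diff powr_divide)
    then show ?thesis by simp
  qed
  \<comment> \<open>The bases are at least 1, so replacing p k by the smaller M q can only increase
    the factors.\<close>
  also have "\<dots> \<le> F powr (1 / q) * (\<Prod>k\<in>{..<m}-{i}. (\<Lambda> k / F) powr (1 / (M * q)))"
  proof (intro mult_left_mono prod_mono conjI)
    fix k assume "k \<in> {..<m} - {i}"
    then have k: "k < m" "k \<noteq> i" by auto
    have "0 < M * q" using M q_facts(1) by simp
    then show "(\<Lambda> k / F) powr (1 / p k) \<le> (\<Lambda> k / F) powr (1 / (M * q))"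
      using \<Lambda>[OF k] F p_ge[OF k] p_pos[OF k(1)] unfolding M_def[symmetric]
      by (intro powr_mono divide_left_mono mult_pos_pos[of "p k"]) auto
  qed auto
  \<comment> \<open>F^(1/q) is distributed equally over the M factors, where it cancels the
    denominators.\<close>
  also have "\<dots> = (\<Prod>k\<in>{..<m}-{i}. F powr (1 / (M * q)) * (\<Lambda> k / F) powr (1 / (M * q)))"
  proof -
    have "(\<Prod>k\<in>{..<m}-{i}. F powr (1 / (M * q))) = F powr (1 / (M * q) * M)"
      using F card_other_modes by (simp add: powr_power M_def)
    also have "1 / (M * q) * M = 1 / q" using M by simp
    finally show ?thesis by (simp add: prod.distrib)
  qed
  also have "\<dots> = (\<Prod>k\<in>{..<m}-{i}. \<Lambda> k powr (1 / (M * q)))"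
  proof (intro prod.cong refl)
    fix k assume "k \<in> {..<m} - {i}"
    then have "\<Lambda> k > 0" using \<Lambda>[of k] F by auto
    then show "F powr (1 / (M * q)) * (\<Lambda> k / F) powr (1 / (M * q)) = \<Lambda> k powr (1 / (M * q))"
      using F by (simp add: powr_mult[symmetric])
  qed
  finally have "tnorm m d p f \<le> (\<Prod>k\<in>{..<m}-{i}. \<Lambda> k powr (1 / (M * q)))"
    using w Qf_Spp by simp
  moreover have "0 \<le> tnorm m d p f"
    using w Qf_Spp positive_mlf_pos[OF Spp_positive[OF w(1)]] by simp
  ultimately have "tnorm m d p f powr (q * M) \<le> (\<Prod>k\<in>{..<m}-{i}. \<Lambda> k powr (1 / (M * q))) powr (q * M)"
    using M q_facts(1) by (intro powr_mono2) auto
  also have "\<dots> = (\<Prod>k\<in>{..<m}-{i}. (\<Lambda> k powr (1 / (M * q))) powr (q * M))"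
    by (rule prod_powr_distrib)
  also have "\<dots> = (\<Prod>k\<in>{..<m}-{i}. \<Lambda> k)"
  proof (intro prod.cong refl)
    fix k assume "k \<in> {..<m} - {i}"
    then have "\<Lambda> k > 0" using \<Lambda>[of k] F by auto
    moreover have "1 / (M * q) * (q * M) = 1" using M q_facts(1) by simp
    ultimately show "(\<Lambda> k powr (1 / (M * q))) powr (q * M) = \<Lambda> k"
      unfolding powr_powr by simp
  qed
  finally show ?thesis by (simp add: M_def \<Lambda>_def)
qed

text \<open>At a maximizer the gradient in mode i is T x_i^(p_i - 1), so the dual vector is T^(q-1)
  x_i and lifting merely rescales block i. The critical point equation in mode k contributes one
  more factor T.\<close>

lemma quot_maximizer:
  assumes x: "x \<in> Spp m d p" "Qf m d p f x = tnorm m d p f" and k: "k < m" "k \<noteq> i" "j < d k"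
  shows "quot x k j = tnorm m d p f powr q"
proof -
  note xp = Spp_positive[OF x(1)]
  define T where "T = tnorm m d p f"
  have T: "mlf m d f x = T" "T > 0" using x Qf_Spp positive_mlf_pos[OF xp] by (auto simp: T_def)
  have dual: "dual x j = T powr (q - 1) * x i j" if "j < d i" for j
  proof -
    have "(x i j powr (p i - 1)) powr (q - 1) = x i j"
      using positiveD[OF xp i that] p1[OF i] by (simp add: powr_powr q_facts(2))
    then show ?thesis
      using maximizer_pd_eq[OF x i that] T by (simp add: dual_def powr_mult)
  qed
  have "pd m d f k j (lift x) = pd m d f k j (x(i := \<lambda>j. T powr (q - 1) * x i j))"
    by (rule pd_cong) (auto simp: lift_def dual)
  also have "\<dots> = T powr (q - 1) * (T * x k j powr (p k - 1))"
    using pd_scale[of i m k] i k maximizer_pd_eq[OF x k(1,3)] T by simp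
  finally have "pd m d f k j (lift x) = T powr q * x k j powr (p k - 1)"
    using T(2) by (simp add: powr_diff)
  then show ?thesis
    unfolding quot_eq[OF xp k] T_def[symmetric] using positiveD[OF xp k(1,3)] by simp
qed

lemma prod_quot_maximizer:
  assumes x: "x \<in> Spp m d p" "Qf m d p f x = tnorm m d p f"
  shows "(\<Prod>k\<in>{..<m}-{i}. Min (quot x k ` {..<d k})) = tnorm m d p f powr (q * real (m - 1))"
    and "(\<Prod>k\<in>{..<m}-{i}. Max (quot x k ` {..<d k})) = tnorm m d p f powr (q * real (m - 1))"
proof -
  have image: "quot x k ` {..<d k} = {tnorm m d p f powr q}" if "k \<in> {..<m}-{i}" for k
  proof -
    have "0 \<in> {..<d k}" using d1[of k] that by auto
    then show ?thesis using quot_maximizer[OF x, of k] that by (auto simp: image_iff)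
  qed
  show "(\<Prod>k\<in>{..<m}-{i}. Min (quot x k ` {..<d k})) = tnorm m d p f powr (q * real (m - 1))"
    and "(\<Prod>k\<in>{..<m}-{i}. Max (quot x k ` {..<d k})) = tnorm m d p f powr (q * real (m - 1))"
    by (simp_all only: image Min_singleton Max_singleton prod_constant card_other_modes powr_modes cong: prod.cong)
qed

end

text \<open>The hypothesis rearranges to M p_i <= p_k (p_i - 1), where M = m - 1. The M reciprocals
  1 / p_k then sum to at most 1 / q, which complements 1 / p_i to 1.\<close>

lemma exponent_condition:
  assumes "m \<ge> 2" "\<forall>k<m. 1 < p k" "i < m"
    and cond: "real (m - 1) \<le> (p i - 1) * (Min (p ` ({..<m} - {i})) - real (m - 1))"
  shows "\<And>k. k < m \<Longrightarrow> k \<noteq> i \<Longrightarrow> real (m - 1) * conj_exp (p i) \<le> p k"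
    and "(\<Sum>k<m. 1 / p k) \<le> 1"
proof -
  have pi: "1 < p i" using assms by simp
  define M where "M = real (m - 1)"
  have M: "M \<ge> 1" using assms(1) by (simp add: M_def)
  have *: "M * conj_exp (p i) \<le> p k" if "k < m" "k \<noteq> i" for k
  proof -
    have "Min (p ` ({..<m} - {i})) \<le> p k" using that by (intro Min_le) auto
    then have "(p i - 1) * (Min (p ` ({..<m} - {i})) - M) \<le> (p i - 1) * (p k - M)"
      using pi by (intro mult_left_mono) auto
    then have "M * p i \<le> p k * (p i - 1)" using cond unfolding M_def[symmetric] by (simp add: algebra_simps)
    then show ?thesis using pi by (simp add: conj_exp_def pos_divide_le_eq)
  qed
  then show "\<And>k. k < m \<Longrightarrow> k \<noteq> i \<Longrightarrow> real (m - 1) * conj_exp (p i) \<le> p k" by (simp add: M_def)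
  have q: "conj_exp (p i) > 1" "1 / p i + 1 / conj_exp (p i) = 1" using conj_exp_facts[OF pi] by auto
  have "(\<Sum>k<m. 1 / p k) = 1 / p i + (\<Sum>k\<in>{..<m}-{i}. 1 / p k)"
    using assms(3) by (intro sum.remove) auto
  also have "\<dots> \<le> 1 / p i + (\<Sum>k\<in>{..<m}-{i}. 1 / (M * conj_exp (p i)))"
  proof (intro add_left_mono sum_mono)
    fix k assume "k \<in> {..<m} - {i}"
    then show "1 / p k \<le> 1 / (M * conj_exp (p i))"
      using *[of k] M q by (intro divide_left_mono mult_pos_pos) (auto intro: less_le_trans[of 0 "M * conj_exp (p i)"])
  qed
  also have "\<dots> = 1 / p i + M * (1 / (M * conj_exp (p i)))"
    using assms(3) by (simp add: M_def)
  also have "\<dots> = 1" using M q by simp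
  finally show "(\<Sum>k<m. 1 / p k) \<le> 1" .
qed

theorem theorem1:
  fixes m :: nat and d :: "nat \<Rightarrow> nat" and f :: "(nat \<Rightarrow> nat) \<Rightarrow> real"
    and p :: "nat \<Rightarrow> real" and i :: nat
  assumes "m \<ge> 2"
    and "\<forall>k<m. d k \<ge> 1"
    and "weakly_irreducible m d f"
    and "\<forall>k<m. 1 < p k"
    and "i < m"
    and "real (m - 1) \<le> (p i - 1) * (Min (p ` ({..<m} - {i})) - real (m - 1))"
  shows "(\<exists>!x. x \<in> Spp m d p \<and> Qf m d p f x = tnorm m d p f)
    \<and> (\<exists>x\<in>Spp m d p. (\<Prod>\<nu>\<in>{..<m} - {i}. Min ((\<lambda>j. (sfun m d p f i \<nu> j x / x \<nu> j) powr (p \<nu> - 1)) ` {..<d \<nu>}))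
                        = tnorm m d p f powr (conj_exp (p i) * real (m - 1)))
    \<and> (\<forall>x\<in>Spp m d p. (\<Prod>\<nu>\<in>{..<m} - {i}. Min ((\<lambda>j. (sfun m d p f i \<nu> j x / x \<nu> j) powr (p \<nu> - 1)) ` {..<d \<nu>}))
                        \<le> tnorm m d p f powr (conj_exp (p i) * real (m - 1)))
    \<and> (\<exists>x\<in>Spp m d p. (\<Prod>\<nu>\<in>{..<m} - {i}. Max ((\<lambda>j. (sfun m d p f i \<nu> j x / x \<nu> j) powr (p \<nu> - 1)) ` {..<d \<nu>}))
                        = tnorm m d p f powr (conj_exp (p i) * real (m - 1)))
    \<and> (\<forall>x\<in>Spp m d p. (\<Prod>\<nu>\<in>{..<m} - {i}. Max ((\<lambda>j. (sfun m d p f i \<nu> j x / x \<nu> j) powr (p \<nu> - 1)) ` {..<d \<nu>}))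
                        \<ge> tnorm m d p f powr (conj_exp (p i) * real (m - 1)))
    \<and> (irreducible_tensor m d f \<longrightarrow>
         (\<forall>x. x \<in> Spp m d p \<and> Qf m d p f x = tnorm m d p f \<longrightarrow>
            (\<forall>k<m. \<forall>j<d k. x k j > 0) \<and> singular_vector m d p f x \<and>
            (\<forall>y. singular_vector m d p f y \<and> (\<forall>k<m. \<forall>j<d k. y k j \<ge> 0) \<longrightarrow>
               (\<exists>c. (\<forall>k<m. c k > 0) \<and> (\<forall>k<m. \<forall>j<d k. y k j = c k * x k j)))))"
proof -
  interpret perron_frobenius_tensor_mode m d p f i
    using assms exponent_condition[OF assms(1,4,5,6)] by unfold_locales auto
  obtain x where x: "x \<in> Spp m d p" "Qf m d p f x = tnorm m d p f" using ex_Qf_eq_tnorm by blast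
  have "\<exists>!x. x \<in> Spp m d p \<and> Qf m d p f x = tnorm m d p f"
  proof (rule ex1I[of _ x])
    fix y assume y: "y \<in> Spp m d p \<and> Qf m d p f y = tnorm m d p f"
    show "y = x"
      \<comment> \<open>Here \<open>y\<close> is the stationary point and \<open>x\<close> the
        competitor with the same value.\<close>
      by (rule stationary_unique) (use x y maximizer_pd_eq Qf_Spp in auto)
  qed (use x in auto)
  moreover have "singular_vector m d p f x" if "x \<in> Spp m d p" "Qf m d p f x = tnorm m d p f" for x
    using maximizer_stationary[OF that] positive_admissible positive_mlf_pos[of x] Spp_positive[OF that(1)]
    by (simp add: singular_vector_def)
  moreover have "\<forall>x\<in>Spp m d p. \<forall>k<m. \<forall>j<d k. x k j > 0"
    using Spp_positive by (simp add: positive_def)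
  moreover note prod_Min_quot_le tnorm_le_prod_Max_quot
  moreover have "\<exists>x\<in>Spp m d p. (\<Prod>k\<in>{..<m}-{i}. Min (quot x k ` {..<d k})) = tnorm m d p f powr (q * real (m - 1))"
    "\<exists>x\<in>Spp m d p. (\<Prod>k\<in>{..<m}-{i}. Max (quot x k ` {..<d k})) = tnorm m d p f powr (q * real (m - 1))"
    using prod_quot_maximizer[OF x] x(1) by blast+
  ultimately show ?thesis
    unfolding quot_def[symmetric] by (simp add: nonneg_singular_vector_unique)
qed

end
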